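(* Let $s\in[1,\infty)$ and let $\varphi=\sum_{|\alpha|\ge1}d_\alpha Z_\alpha$ be a formal power series in noncommuting indeterminates $Z_1,\ldots,Z_n$ such that $d_\alpha\ge0$ for all $\alpha$ and $d_{g_i}>0$ for $i\in\{1,\ldots,n\}$. Consider the formal power series $\psi_s$ with inverse $$\psi_s^{-1}=(1-\varphi)^s:=\sum_{k=0}^\infty(-1)^k\binom{s}{k}\varphi^k=1+\sum_{|\alpha|\ge1}a_\alpha Z_\alpha$$ and let $\psi_s=1+\sum_{|\alpha|\ge1}b_\alpha Z_\alpha$. Then the coefficients $\{b_\alpha\}$ satisfy the inequalities $$\frac{b_\alpha}{b_{g_i\alpha}}\le\frac1{d_{g_i}}\quad\text{and}\quad\frac{b_\alpha}{b_{\alpha g_i}}\le\frac1{d_{g_i}}$$ for any $\alpha\in\mathbb F_n^+$ and $i\in\{1,\ldots,n\}$. Moreover, if $\varphi$ is a noncommutative polynomial, then $\psi_s$ is an admissible free holomorphic function for every $s\ge1$.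
   Context: $\mathbb F_n^+$ is the unital free semigroup on generators $g_1,\ldots,g_n$ with identity $g_0$; $|\alpha|$ is the length of $\alpha$; $b_{g_0}=1$. For $\alpha=g_{i_1}\cdots g_{i_k}$, $Z_\alpha:=Z_{i_1}\cdots Z_{i_k}$, $Z_{g_0}:=1$. $\binom{s}{k}=\frac{s(s-1)\cdots(s-k+1)}{k!}$. A formal power series $\sum_\alpha c_\alpha Z_\alpha$ is a free holomorphic function in a neighborhood of the origin if there is $\rho>0$ such that $\sum_{k}\sum_{|\alpha|=k}c_\alpha X_\alpha$ converges in norm for every Hilbert space $\mathcal H$ and every $X\in B(\mathcal H)^n$ with $\|\sum_iX_iX_i^*\|^{1/2}\le\rho$; equivalently $\limsup_k(\sum_{|\alpha|=k}|c_\alpha|^2)^{1/2k}<\infty$. A series $g=1+\sum_{|\alpha|\ge1}b_\alpha Z_\alpha$ is an admissible free holomorphic function if: (a) $b_{g_0}=1$, all $b_\alpha>0$, and $\sup_\alpha b_\alpha/b_{g_i\alpha}<\infty$ for each $i$; (b) $g$ is free holomorphic in a neighborhood of the origin; (c) $\sup_{k}\big\|\sum_{p=0}^k\sum_{|\alpha|=p}a_\alpha W_\alpha W_\alpha^*\big\|<\infty$, where $g^{-1}=1+\sum_{|\alpha|\ge1}a_\alpha Z_\alpha$ is the inverse power series ($a_{g_0}=1$) and $W_1,\ldots,W_n$ are the weighted left creation operators $W_ie_\alpha=\sqrt{b_\alpha/b_{g_i\alpha}}\,e_{g_i\alpha}$ on the full Fock space $F^2(H_n)$ with orthonormal basis $\{e_\alpha\}_{\alpha\in\mathbb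 F_n^+}$ ($W_\alpha=W_{i_1}\cdots W_{i_k}$). *)

theory Defs
  imports "HOL-Analysis.Analysis"
begin

section \<open>Formal power series in noncommuting indeterminates\<close>

text \<open>
  The indeterminates \<open>Z\<^sub>1, \<dots>, Z\<^sub>n\<close> are indexed by a finite type \<open>'n\<close> with \<open>CARD('n) = n\<close>. The free
  semigroup \<open>\<bbbF>\<^sub>n\<^sup>+\<close> is \<open>'n list\<close>: its identity is \<open>[]\<close>, its product is \<open>@\<close>, the length of a word is
  \<^const>\<open>length\<close>; hence \<open>g\<^sub>i \<alpha>\<close> is \<open>i # \<alpha>\<close> and \<open>\<alpha> g\<^sub>i\<close> is \<open>\<alpha> @ [i]\<close>.
\<close>

typedef ('n, 'a) ncps = "UNIV :: ('n list \<Rightarrow> 'a) set"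
  morphisms coeff Abs_ncps
  by simp

lemma coeff_Abs_ncps [simp]: "coeff (Abs_ncps f) w = f w"
  by (simp add: Abs_ncps_inverse)

lemma ncps_eq_iff: "f = g \<longleftrightarrow> (\<forall>w. coeff f w = coeff g w)"
  by (simp add: coeff_inject [symmetric] fun_eq_iff)

text \<open>The Cauchy product; \<open>(take k w, drop k w)\<close> with \<open>k \<le> length w\<close> runs through the
  factorizations of the word \<open>w\<close>.\<close>

definition conv :: "('n list \<Rightarrow> 'a) \<Rightarrow> ('n list \<Rightarrow> 'a) \<Rightarrow> 'n list \<Rightarrow> 'a::semiring_0"
  where "conv f g w = (\<Sum>k\<le>length w. f (take k w) * g (drop k w))"

lemma conv_Nil: "conv f g [] = f [] * g []"
  by (simp add: conv_def)

lemma conv_Cons: "conv f g (x # w) = f [] * g (x # w) + conv (\<lambda>u. f (x # u)) g w"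
  by (simp add: conv_def sum.atMost_Suc_shift del: sum.atMost_Suc)

lemma conv_add_left: "conv (\<lambda>u. f u + g u) h w = conv f h w + conv g h w"
  by (simp add: conv_def distrib_right sum.distrib)

lemma conv_add_right: "conv f (\<lambda>u. g u + h u) w = conv f g w + conv f h w"
  by (simp add: conv_def distrib_left sum.distrib)

lemma conv_mult_left: "conv (\<lambda>u. c * f u) g w = c * conv f g w"
  by (simp add: conv_def sum_distrib_left mult.assoc)

lemma conv_assoc: "conv (conv f g) h w = conv f (conv g h) w"
proof (induction w arbitrary: f)
  case Nil
  show ?case by (simp add: conv_Nil mult.assoc)
next
  case (Cons x w)
  have "conv (\<lambda>u. conv f g (x # u)) h w
      = f [] * conv (\<lambda>u. g (x # u)) h w + conv (conv (\<lambda>u. f (x # u)) g) h w"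
    by (simp add: conv_Cons conv_add_left conv_mult_left)
  then show ?case
    by (simp add: conv_Cons conv_Nil Cons.IH distrib_left mult.assoc add.assoc)
qed

lemma conv_one_left: "conv (\<lambda>u. if u = [] then 1 else 0) f w = (f w :: 'a::semiring_1)"
proof (cases w)
  case Nil
  then show ?thesis by (simp add: conv_Nil)
next
  case (Cons x v)
  then show ?thesis by (simp add: conv_Cons) (simp add: conv_def)
qed

lemma conv_one_right: "conv f (\<lambda>u. if u = [] then 1 else 0) w = (f w :: 'a::semiring_1)"
  by (induction w arbitrary: f) (simp_all add: conv_Nil conv_Cons)

instantiation ncps :: (type, ring_1) ring_1
begin

definition "0 = Abs_ncps (\<lambda>w. 0)"
definition "1 = Abs_ncps (\<lambda>w. if w = [] then 1 else 0)"
definition "f + g = Abs_ncps (\<lambda>w. coeff f w + coeff g w)"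
definition "- f = Abs_ncps (\<lambda>w. - coeff f w)"
definition "f - g = Abs_ncps (\<lambda>w. coeff f w - coeff g w)"
definition "f * g = Abs_ncps (conv (coeff f) (coeff g))"

instance
proof
  fix f g h :: "('a, 'b) ncps"
  show "f * g * h = f * (g * h)"
    by (simp add: times_ncps_def ncps_eq_iff conv_assoc Abs_ncps_inverse)
  show "1 * f = f"
    by (simp add: times_ncps_def one_ncps_def ncps_eq_iff Abs_ncps_inverse conv_one_left)
  show "f * 1 = f"
    by (simp add: times_ncps_def one_ncps_def ncps_eq_iff Abs_ncps_inverse conv_one_right)
  show "(f + g) * h = f * h + g * h"
    by (simp add: times_ncps_def plus_ncps_def ncps_eq_iff Abs_ncps_inverse conv_add_left)
  show "f * (g + h) = f * g + f * h"
    by (simp add: times_ncps_def plus_ncps_def ncps_eq_iff Abs_ncps_inverse conv_add_right)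
  show "(0 :: ('a, 'b) ncps) \<noteq> 1"
    by (auto simp: zero_ncps_def one_ncps_def ncps_eq_iff)
qed (simp_all add: zero_ncps_def plus_ncps_def minus_ncps_def uminus_ncps_def ncps_eq_iff
      add.assoc add.commute)

end

lemma coeff_one: "coeff 1 w = (if w = [] then 1 else 0)"
  by (simp add: one_ncps_def)

lemma coeff_mult: "coeff (f * g) w = (\<Sum>k\<le>length w. coeff f (take k w) * coeff g (drop k w))"
  by (simp add: times_ncps_def conv_def)

definition ncps_inverse :: "('n, 'a::ring_1) ncps \<Rightarrow> ('n, 'a) ncps"
  where "ncps_inverse f = (THE g. f * g = 1 \<and> g * f = 1)"

text \<open>\<open>(1 - \<phi>)\<^sup>s = \<Sum>\<^sub>k (-1)\<^sup>k (s choose k) \<phi>\<^sup>k\<close>, coefficient by coefficient. When \<open>coeff \<phi> [] = 0\<close>, the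
  coefficient of \<open>\<phi>\<^sup>k\<close> at \<open>w\<close> vanishes for \<open>k > length w\<close>, so each of these sums is finite.\<close>

definition one_minus_powr :: "('n, real) ncps \<Rightarrow> real \<Rightarrow> ('n, real) ncps"
  where "one_minus_powr \<phi> s = Abs_ncps (\<lambda>w. \<Sum>k. (-1) ^ k * (s gchoose k) * coeff (\<phi> ^ k) w)"

definition ncps_polynomial :: "('n, 'a::zero) ncps \<Rightarrow> bool"
  where "ncps_polynomial f \<longleftrightarrow> finite {w. coeff f w \<noteq> 0}"


section \<open>Complex Hilbert spaces\<close>

text \<open>The inner product is linear in its first argument.\<close>

class complex_hilbert = banach +
  fixes scaleC :: "complex \<Rightarrow> 'a \<Rightarrow> 'a"  (infixr \<open>*\<^sub>C\<close> 75)
    and cinner :: "'a \<Rightarrow> 'a \<Rightarrow> complex"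
  assumes scaleC_add_right: "c *\<^sub>C (x + y) = c *\<^sub>C x + c *\<^sub>C y"
    and scaleC_add_left: "(c + d) *\<^sub>C x = c *\<^sub>C x + d *\<^sub>C x"
    and scaleC_scaleC: "c *\<^sub>C (d *\<^sub>C x) = (c * d) *\<^sub>C x"
    and scaleC_of_real: "complex_of_real r *\<^sub>C x = r *\<^sub>R x"
    and cinner_add_left: "cinner (x + y) z = cinner x z + cinner y z"
    and cinner_scaleC_left: "cinner (c *\<^sub>C x) y = c * cinner x y"
    and cinner_commute: "cinner x y = cnj (cinner y x)"
    and cinner_self: "cinner x x = complex_of_real ((norm x)\<^sup>2)"

text \<open>Bounded operators are elements of the library type \<open>'h \<Rightarrow>\<^sub>L 'h\<close>, with its operator norm, that
  are moreover complex-linear.\<close>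

definition clinear_op :: "('h::complex_hilbert \<Rightarrow>\<^sub>L 'h) \<Rightarrow> bool"
  where "clinear_op A \<longleftrightarrow> (\<forall>c x. blinfun_apply A (c *\<^sub>C x) = c *\<^sub>C blinfun_apply A x)"

definition cadjoint :: "('h::complex_hilbert \<Rightarrow>\<^sub>L 'h) \<Rightarrow> ('h \<Rightarrow>\<^sub>L 'h)"
  where "cadjoint A =
    (THE B. \<forall>x y. cinner (blinfun_apply A x) y = cinner x (blinfun_apply B y))"

primrec op_word :: "('n \<Rightarrow> 'h::real_normed_vector \<Rightarrow>\<^sub>L 'h) \<Rightarrow> 'n list \<Rightarrow> ('h \<Rightarrow>\<^sub>L 'h)"
  where
    "op_word X [] = id_blinfun"
  | "op_word X (i # \<alpha>) = X i o\<^sub>L op_word X \<alpha>"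


section \<open>The full Fock space\<close>

text \<open>\<open>\<ell>\<^sup>2\<close> over an arbitrary index type; the full Fock space \<open>F\<^sup>2(H\<^sub>n)\<close> with its orthonormal basis
  \<open>{e\<^sub>\<alpha>}\<close> indexed by words is \<open>\<ell>\<^sup>2\<close> over \<open>'n list\<close>.\<close>

typedef 'i ell2 = "{f :: 'i \<Rightarrow> complex. (\<lambda>i. (cmod (f i))\<^sup>2) summable_on UNIV}"
  morphisms ell2_nth Abs_ell2
  by (rule exI [of _ "\<lambda>_. 0"]) simp

setup_lifting type_definition_ell2

lemma ell2_eq_iff: "x = y \<longleftrightarrow> (\<forall>i. ell2_nth x i = ell2_nth y i)"
  by (simp add: ell2_nth_inject [symmetric] fun_eq_iff)

lemma ell2_summable: "(\<lambda>i. (cmod (ell2_nth x i))\<^sup>2) summable_on UNIV"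
  using ell2_nth [of x] by simp

lemma sum_eq_L2_set_sq: "(\<Sum>i\<in>F. (f i)\<^sup>2) = (L2_set f F)\<^sup>2"
  unfolding L2_set_def by (rule real_sqrt_pow2 [symmetric]) (simp add: sum_nonneg)

lemma sq_summable_iff:
  fixes f :: "'i \<Rightarrow> complex"
  shows "(\<lambda>i. (cmod (f i))\<^sup>2) summable_on UNIV
    \<longleftrightarrow> (\<exists>B. \<forall>F. finite F \<longrightarrow> L2_set (\<lambda>i. cmod (f i)) F \<le> B)"
proof
  assume s: "(\<lambda>i. (cmod (f i))\<^sup>2) summable_on UNIV"
  have "L2_set (\<lambda>i. cmod (f i)) F \<le> sqrt (\<Sum>\<^sub>\<infinity>i. (cmod (f i))\<^sup>2)" if "finite F" for F
    unfolding L2_set_def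
    by (intro real_sqrt_le_mono finite_sum_le_infsum s that) auto
  then show "\<exists>B. \<forall>F. finite F \<longrightarrow> L2_set (\<lambda>i. cmod (f i)) F \<le> B" by blast
next
  assume "\<exists>B. \<forall>F. finite F \<longrightarrow> L2_set (\<lambda>i. cmod (f i)) F \<le> B"
  then obtain B where B: "\<And>F. finite F \<Longrightarrow> L2_set (\<lambda>i. cmod (f i)) F \<le> B" by blast
  have "(\<Sum>i\<in>F. (cmod (f i))\<^sup>2) \<le> B\<^sup>2" if "finite F" for F
    unfolding sum_eq_L2_set_sq by (rule power_mono [OF B [OF that] L2_set_nonneg])
  then show "(\<lambda>i. (cmod (f i))\<^sup>2) summable_on UNIV"
    by (intro nonneg_bdd_above_summable_on) (auto intro!: bdd_aboveI)
qed

lemma L2_set_cmod_add_le: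
  "L2_set (\<lambda>i. cmod (f i + g i)) F \<le> L2_set (\<lambda>i. cmod (f i)) F + L2_set (\<lambda>i. cmod (g i)) F"
  by (rule order_trans [OF L2_set_mono L2_set_triangle_ineq]) (auto intro: norm_triangle_ineq)

lemma sq_summable_add:
  fixes f g :: "'i \<Rightarrow> complex"
  assumes "(\<lambda>i. (cmod (f i))\<^sup>2) summable_on UNIV" "(\<lambda>i. (cmod (g i))\<^sup>2) summable_on UNIV"
  shows "(\<lambda>i. (cmod (f i + g i))\<^sup>2) summable_on UNIV"
proof -
  obtain B where B: "\<forall>F. finite F \<longrightarrow> L2_set (\<lambda>i. cmod (f i)) F \<le> B"
    using assms(1) unfolding sq_summable_iff by (rule exE)
  obtain C where C: "\<forall>F. finite F \<longrightarrow> L2_set (\<lambda>i. cmod (g i)) F \<le> C"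
    using assms(2) unfolding sq_summable_iff by (rule exE)
  have "\<forall>F. finite F \<longrightarrow> L2_set (\<lambda>i. cmod (f i + g i)) F \<le> B + C"
    using B C by (simp add: order_trans [OF L2_set_cmod_add_le] add_mono)
  then show ?thesis unfolding sq_summable_iff by blast
qed

lemma sq_summable_mult:
  fixes f :: "'i \<Rightarrow> complex"
  assumes "(\<lambda>i. (cmod (f i))\<^sup>2) summable_on UNIV"
  shows "(\<lambda>i. (cmod (c * f i))\<^sup>2) summable_on UNIV"
  using summable_on_cmult_right [OF assms, of "(cmod c)\<^sup>2"]
  by (simp add: norm_mult power_mult_distrib)

lemma sq_summable_diff:
  fixes f g :: "'i \<Rightarrow> complex"
  assumes "(\<lambda>i. (cmod (f i))\<^sup>2) summable_on UNIV" "(\<lambda>i. (cmod (g i))\<^sup>2) summable_on UNIV"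
  shows "(\<lambda>i. (cmod (f i - g i))\<^sup>2) summable_on UNIV"
  using sq_summable_add [OF assms(1) sq_summable_mult [OF assms(2), of "- 1"]] by simp

lemma mult_cnj_summable:
  fixes f g :: "'i \<Rightarrow> complex"
  assumes "(\<lambda>i. (cmod (f i))\<^sup>2) summable_on UNIV" "(\<lambda>i. (cmod (g i))\<^sup>2) summable_on UNIV"
  shows "(\<lambda>i. f i * cnj (g i)) summable_on UNIV"
proof -
  have le: "norm (f i * cnj (g i)) \<le> norm ((cmod (f i))\<^sup>2 + (cmod (g i))\<^sup>2)" for i
  proof -
    have "2 * (cmod (f i) * cmod (g i)) \<le> (cmod (f i))\<^sup>2 + (cmod (g i))\<^sup>2"
      using sum_squares_bound [of "cmod (f i)" "cmod (g i)"] by simp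
    moreover have "0 \<le> cmod (f i) * cmod (g i)" by simp
    ultimately show ?thesis
      unfolding norm_mult complex_mod_cnj real_norm_def by linarith
  qed
  have "(\<lambda>i. norm ((cmod (f i))\<^sup>2 + (cmod (g i))\<^sup>2)) summable_on UNIV"
    using summable_on_add [OF assms] by simp
  then have "(\<lambda>i. norm (f i * cnj (g i))) summable_on UNIV"
    by (rule Infinite_Sum.abs_summable_on_comparison_test) (rule le)
  then show ?thesis by (rule Infinite_Sum.abs_summable_summable)
qed

instantiation ell2 :: (type) real_vector
begin

lift_definition zero_ell2 :: "'a ell2" is "\<lambda>_. 0" by simp
lift_definition plus_ell2 :: "'a ell2 \<Rightarrow> 'a ell2 \<Rightarrow> 'a ell2" is "\<lambda>f g i. f i + g i"
  by (rule sq_summable_add)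
lift_definition uminus_ell2 :: "'a ell2 \<Rightarrow> 'a ell2" is "\<lambda>f i. - f i" by simp
lift_definition minus_ell2 :: "'a ell2 \<Rightarrow> 'a ell2 \<Rightarrow> 'a ell2" is "\<lambda>f g i. f i - g i"
  by (rule sq_summable_diff)
lift_definition scaleR_ell2 :: "real \<Rightarrow> 'a ell2 \<Rightarrow> 'a ell2" is "\<lambda>r f i. complex_of_real r * f i"
  by (rule sq_summable_mult)

instance
proof
  fix x y z :: "'a ell2" and r s :: real
  show "x + y + z = x + (y + z)" "x + y = y + x" "0 + x = x" "- x + x = 0" "x - y = x + - y"
    by (simp_all add: ell2_eq_iff zero_ell2.rep_eq plus_ell2.rep_eq uminus_ell2.rep_eq
        minus_ell2.rep_eq add.assoc add.commute)
  show "r *\<^sub>R (x + y) = r *\<^sub>R x + r *\<^sub>R y" "(r + s) *\<^sub>R x = r *\<^sub>R x + s *\<^sub>R x"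
    "r *\<^sub>R s *\<^sub>R x = (r * s) *\<^sub>R x" "1 *\<^sub>R x = x"
    by (simp_all add: ell2_eq_iff plus_ell2.rep_eq scaleR_ell2.rep_eq
        distrib_left distrib_right mult.assoc)
qed

end

instantiation ell2 :: (type) real_normed_vector
begin

lift_definition norm_ell2 :: "'a ell2 \<Rightarrow> real" is "\<lambda>f. sqrt (\<Sum>\<^sub>\<infinity>i. (cmod (f i))\<^sup>2)" .
definition dist_ell2 :: "'a ell2 \<Rightarrow> 'a ell2 \<Rightarrow> real"
  where "dist_ell2 x y = norm (x - y)"
definition sgn_ell2 :: "'a ell2 \<Rightarrow> 'a ell2"
  where "sgn_ell2 x = x /\<^sub>R norm x"
definition uniformity_ell2 :: "('a ell2 \<times> 'a ell2) filter"
  where "uniformity_ell2 = (INF e\<in>{0 <..}. principal {(x, y). dist x y < e})"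
definition open_ell2 :: "'a ell2 set \<Rightarrow> bool"
  where "open_ell2 U \<longleftrightarrow> (\<forall>x\<in>U. \<forall>\<^sub>F (x', y) in uniformity. x' = x \<longrightarrow> y \<in> U)"

lemma ell2_norm_le:
  fixes x :: "'a ell2"
  assumes "0 \<le> B" "\<And>F. finite F \<Longrightarrow> L2_set (\<lambda>i. cmod (ell2_nth x i)) F \<le> B"
  shows "norm x \<le> B"
proof -
  have "(\<Sum>i\<in>F. (cmod (ell2_nth x i))\<^sup>2) \<le> B\<^sup>2" if "finite F" for F
    unfolding sum_eq_L2_set_sq by (rule power_mono [OF assms(2) [OF that] L2_set_nonneg])
  then have "(\<Sum>\<^sub>\<infinity>i. (cmod (ell2_nth x i))\<^sup>2) \<le> B\<^sup>2"
    by (rule infsum_le_finite_sums [OF ell2_summable])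
  then show ?thesis
    unfolding norm_ell2.rep_eq by (rule real_le_lsqrt [OF assms(1)])
qed

lemma L2_set_le_ell2_norm:
  fixes x :: "'a ell2"
  assumes "finite F"
  shows "L2_set (\<lambda>i. cmod (ell2_nth x i)) F \<le> norm x"
  unfolding L2_set_def norm_ell2.rep_eq
  by (rule real_sqrt_le_mono [OF finite_sum_le_infsum [OF ell2_summable assms]]) simp_all

lemma cmod_le_ell2_norm:
  fixes x :: "'a ell2"
  shows "cmod (ell2_nth x i) \<le> norm x"
  using L2_set_le_ell2_norm [of "{i}" x] by simp

instance
proof
  fix x y :: "'a ell2" and r :: real and U :: "'a ell2 set"
  show "dist x y = norm (x - y)" by (rule dist_ell2_def)
  show "sgn x = x /\<^sub>R norm x" by (rule sgn_ell2_def)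
  show "(uniformity :: ('a ell2 \<times> 'a ell2) filter)
      = (INF e\<in>{0 <..}. principal {(x, y). dist x y < e})"
    by (rule uniformity_ell2_def)
  show "open U \<longleftrightarrow> (\<forall>x\<in>U. \<forall>\<^sub>F (x', y) in uniformity. x' = x \<longrightarrow> y \<in> U)"
    by (rule open_ell2_def)
  show "norm x = 0 \<longleftrightarrow> x = 0"
  proof
    assume "norm x = 0"
    then have "ell2_nth x i = 0" for i using cmod_le_ell2_norm [of x i] by simp
    then show "x = 0" by (simp add: ell2_eq_iff zero_ell2.rep_eq)
  next
    assume "x = 0"
    then show "norm x = 0" by (simp add: norm_ell2.rep_eq zero_ell2.rep_eq)
  qed
  have pos: "0 \<le> norm u" for u :: "'a ell2"
    by (simp add: norm_ell2.rep_eq infsum_nonneg)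
  show "norm (x + y) \<le> norm x + norm y"
  proof (rule ell2_norm_le)
    show "0 \<le> norm x + norm y" by (simp add: pos)
    fix F :: "'a set" assume F: "finite F"
    show "L2_set (\<lambda>i. cmod (ell2_nth (x + y) i)) F \<le> norm x + norm y"
      unfolding plus_ell2.rep_eq
      by (rule order_trans [OF L2_set_cmod_add_le
            add_mono [OF L2_set_le_ell2_norm [OF F] L2_set_le_ell2_norm [OF F]]])
  qed
  show "norm (r *\<^sub>R x) = \<bar>r\<bar> * norm x"
  proof -
    have "(\<lambda>i. (cmod (ell2_nth (r *\<^sub>R x) i))\<^sup>2) = (\<lambda>i. r\<^sup>2 * (cmod (ell2_nth x i))\<^sup>2)"
      by (simp add: scaleR_ell2.rep_eq norm_mult power_mult_distrib)
    then have "(\<Sum>\<^sub>\<infinity>i. (cmod (ell2_nth (r *\<^sub>R x) i))\<^sup>2)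
        = r\<^sup>2 * (\<Sum>\<^sub>\<infinity>i. (cmod (ell2_nth x i))\<^sup>2)"
      by (simp only: infsum_cmult_right')
    then show ?thesis
      by (simp only: norm_ell2.rep_eq real_sqrt_mult real_sqrt_abs)
  qed
qed

end

lemma ell2_complete:
  fixes X :: "nat \<Rightarrow> 'i ell2"
  assumes "Cauchy X"
  shows "convergent X"
proof -
  have "Cauchy (\<lambda>n. ell2_nth (X n) i)" for i
  proof (rule metric_CauchyI)
    fix e :: real assume "0 < e"
    then obtain M where M: "\<forall>m\<ge>M. \<forall>n\<ge>M. dist (X m) (X n) < e"
      using metric_CauchyD [OF assms] by blast
    have le: "dist (ell2_nth (X m) i) (ell2_nth (X n) i) \<le> dist (X m) (X n)" for m n
      using cmod_le_ell2_norm [of "X m - X n" i] by (simp add: dist_norm minus_ell2.rep_eq)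
    show "\<exists>M. \<forall>m\<ge>M. \<forall>n\<ge>M. dist (ell2_nth (X m) i) (ell2_nth (X n) i) < e"
    proof (intro exI allI impI)
      show "dist (ell2_nth (X m) i) (ell2_nth (X n) i) < e" if "M \<le> m" "M \<le> n" for m n
        using M that by (intro le_less_trans [OF le]) simp
    qed
  qed
  then have "convergent (\<lambda>n. ell2_nth (X n) i)" for i
    by (rule Cauchy_convergent)
  then have l: "(\<lambda>n. ell2_nth (X n) i) \<longlonglongrightarrow> lim (\<lambda>n. ell2_nth (X n) i)" for i
    by (simp add: convergent_LIMSEQ_iff)
  define l where "l i = lim (\<lambda>n. ell2_nth (X n) i)" for i
  note l = l [folded l_def]
  have close: "\<exists>M. \<forall>m\<ge>M. \<forall>F. finite F \<longrightarrow> L2_set (\<lambda>i. cmod (ell2_nth (X m) i - l i)) F \<le> e"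
    if "0 < e" for e
  proof -
    obtain M where M: "\<And>m n. m \<ge> M \<Longrightarrow> n \<ge> M \<Longrightarrow> dist (X m) (X n) < e"
      using metric_CauchyD [OF assms \<open>0 < e\<close>] by blast
    have "L2_set (\<lambda>i. cmod (ell2_nth (X m) i - l i)) F \<le> e" if "m \<ge> M" "finite F" for m F
    proof (rule LIMSEQ_le_const2)
      show "(\<lambda>n. L2_set (\<lambda>i. cmod (ell2_nth (X m) i - ell2_nth (X n) i)) F)
          \<longlonglongrightarrow> L2_set (\<lambda>i. cmod (ell2_nth (X m) i - l i)) F"
        unfolding L2_set_def by (intro tendsto_intros l)
      have "L2_set (\<lambda>i. cmod (ell2_nth (X m) i - ell2_nth (X n) i)) F \<le> e" if "n \<ge> M" for n
        using L2_set_le_ell2_norm [OF \<open>finite F\<close>, of "X m - X n"] M [OF \<open>m \<ge> M\<close> that]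
        by (simp add: dist_norm minus_ell2.rep_eq)
      then show "\<exists>N. \<forall>n\<ge>N. L2_set (\<lambda>i. cmod (ell2_nth (X m) i - ell2_nth (X n) i)) F \<le> e"
        by blast
    qed
    then show ?thesis by blast
  qed
  obtain M where M: "\<And>F. finite F \<Longrightarrow> L2_set (\<lambda>i. cmod (ell2_nth (X M) i - l i)) F \<le> 1"
    using close [OF zero_less_one] by blast
  have "(\<lambda>i. (cmod (ell2_nth (X M) i - l i))\<^sup>2) summable_on UNIV"
    unfolding sq_summable_iff by (rule exI [of _ 1]) (simp add: M)
  then have "(\<lambda>i. (cmod (- 1 * (ell2_nth (X M) i - l i)))\<^sup>2) summable_on UNIV"
    by (rule sq_summable_mult)
  then have "(\<lambda>i. (cmod (ell2_nth (X M) i + - 1 * (ell2_nth (X M) i - l i)))\<^sup>2) summable_on UNIV"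
    by (rule sq_summable_add [OF ell2_summable])
  then have nth: "ell2_nth (Abs_ell2 l) = l"
    by (simp add: Abs_ell2_inverse)
  have "X \<longlonglongrightarrow> Abs_ell2 l"
  proof (rule metric_LIMSEQ_I)
    fix e :: real assume "0 < e"
    then obtain M where M: "\<And>m F. m \<ge> M \<Longrightarrow> finite F
        \<Longrightarrow> L2_set (\<lambda>i. cmod (ell2_nth (X m) i - l i)) F \<le> e / 2"
      using close [OF half_gt_zero [OF \<open>0 < e\<close>]] by blast
    have "dist (X m) (Abs_ell2 l) \<le> e / 2" if "m \<ge> M" for m
      unfolding dist_norm
    proof (rule ell2_norm_le)
      show "0 \<le> e / 2" using \<open>0 < e\<close> by simp
      show "L2_set (\<lambda>i. cmod (ell2_nth (X m - Abs_ell2 l) i)) F \<le> e / 2" if "finite F" for F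
        unfolding minus_ell2.rep_eq nth by (rule M [OF \<open>m \<ge> M\<close> that])
    qed
    moreover have "e / 2 < e" using \<open>0 < e\<close> by simp
    ultimately have "\<forall>n\<ge>M. dist (X n) (Abs_ell2 l) < e" by (blast intro: le_less_trans)
    then show "\<exists>N. \<forall>n\<ge>N. dist (X n) (Abs_ell2 l) < e" by (rule exI)
  qed
  then show ?thesis by (rule convergentI)
qed

instantiation ell2 :: (type) complex_hilbert
begin

lift_definition scaleC_ell2 :: "complex \<Rightarrow> 'a ell2 \<Rightarrow> 'a ell2" is "\<lambda>c f i. c * f i"
  by (rule sq_summable_mult)
lift_definition cinner_ell2 :: "'a ell2 \<Rightarrow> 'a ell2 \<Rightarrow> complex"
  is "\<lambda>f g. \<Sum>\<^sub>\<infinity>i. f i * cnj (g i)" .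

instance
proof
  fix x y z :: "'a ell2" and c d :: complex and r :: real
  show "convergent X" if "Cauchy X" for X :: "nat \<Rightarrow> 'a ell2"
    using that by (rule ell2_complete)
  show "c *\<^sub>C (x + y) = c *\<^sub>C x + c *\<^sub>C y" "(c + d) *\<^sub>C x = c *\<^sub>C x + d *\<^sub>C x"
    "c *\<^sub>C d *\<^sub>C x = (c * d) *\<^sub>C x" "complex_of_real r *\<^sub>C x = r *\<^sub>R x"
    by (simp_all add: ell2_eq_iff plus_ell2.rep_eq scaleR_ell2.rep_eq scaleC_ell2.rep_eq
        distrib_left distrib_right mult.assoc)
  show "cinner (x + y) z = cinner x z + cinner y z"
  proof transfer
    fix f g h :: "'a \<Rightarrow> complex"
    assume "(\<lambda>i. (cmod (f i))\<^sup>2) summable_on UNIV" "(\<lambda>i. (cmod (g i))\<^sup>2) summable_on UNIV"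
      "(\<lambda>i. (cmod (h i))\<^sup>2) summable_on UNIV"
    then show "(\<Sum>\<^sub>\<infinity>i. (f i + g i) * cnj (h i))
        = (\<Sum>\<^sub>\<infinity>i. f i * cnj (h i)) + (\<Sum>\<^sub>\<infinity>i. g i * cnj (h i))"
      by (simp add: distrib_right infsum_add mult_cnj_summable)
  qed
  show "cinner (c *\<^sub>C x) y = c * cinner x y"
    by transfer (simp add: mult.assoc infsum_cmult_right')
  show "cinner x y = cnj (cinner y x)"
    by transfer (simp only: infsum_cnj [symmetric] complex_cnj_mult complex_cnj_cnj mult.commute)
  show "cinner x x = complex_of_real ((norm x)\<^sup>2)"
  proof transfer
    fix f :: "'a \<Rightarrow> complex"
    assume "(\<lambda>i. (cmod (f i))\<^sup>2) summable_on UNIV"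
    then have "((\<lambda>i. complex_of_real ((cmod (f i))\<^sup>2)) has_sum
        complex_of_real (\<Sum>\<^sub>\<infinity>i. (cmod (f i))\<^sup>2)) UNIV"
      by (intro has_sum_of_real has_sum_infsum)
    then have "((\<lambda>i. f i * cnj (f i)) has_sum
        complex_of_real (\<Sum>\<^sub>\<infinity>i. (cmod (f i))\<^sup>2)) UNIV"
      by (simp only: complex_norm_square)
    moreover have "(sqrt (\<Sum>\<^sub>\<infinity>i. (cmod (f i))\<^sup>2))\<^sup>2 = (\<Sum>\<^sub>\<infinity>i. (cmod (f i))\<^sup>2)"
      by (rule real_sqrt_pow2) (simp add: infsum_nonneg)
    ultimately show "(\<Sum>\<^sub>\<infinity>i. f i * cnj (f i))
        = complex_of_real ((sqrt (\<Sum>\<^sub>\<infinity>i. (cmod (f i))\<^sup>2))\<^sup>2)"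
      by (simp only: infsumI)
  qed
qed

end

lift_definition fock_basis :: "'n list \<Rightarrow> 'n list ell2"
  is "\<lambda>\<alpha> \<beta>. if \<beta> = \<alpha> then 1 else 0"
proof -
  fix \<alpha> :: "'n list"
  have "(\<lambda>\<beta>. (cmod (if \<beta> = \<alpha> then 1 else 0))\<^sup>2) summable_on UNIV
      \<longleftrightarrow> (\<lambda>\<beta>. 1 :: real) summable_on {\<alpha>}"
    by (rule summable_on_cong_neutral) auto
  then show "(\<lambda>\<beta>. (cmod (if \<beta> = \<alpha> then 1 else 0))\<^sup>2) summable_on UNIV" by simp
qed


section \<open>Admissible free holomorphic functions\<close>

text \<open>Norm convergence of the series on the closed \<open>\<rho>\<close>-ball of \<open>B(\<H>)\<^sup>n\<close>, where \<open>\<H>\<close> is the Hilbert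
  space \<open>'h\<close>. The inner sums are finite because \<open>'n\<close> is.\<close>

definition converges_on_ball ::
    "'h::complex_hilbert itself \<Rightarrow> real \<Rightarrow> ('n::finite, real) ncps \<Rightarrow> bool"
  where "converges_on_ball _ \<rho> g \<longleftrightarrow>
    (\<forall>X :: 'n \<Rightarrow> 'h \<Rightarrow>\<^sub>L 'h. (\<forall>i. clinear_op (X i)) \<longrightarrow>
      sqrt (norm (\<Sum>i\<in>UNIV. X i o\<^sub>L cadjoint (X i))) \<le> \<rho> \<longrightarrow>
      summable (\<lambda>k. \<Sum>\<alpha> | length \<alpha> = k. coeff g \<alpha> *\<^sub>R op_word X \<alpha>))"

text \<open>One formula cannot quantify over all Hilbert spaces, so \<open>'h\<close> is a type parameter; a theorem
  that leaves it free speaks about every Hilbert space. Since the witness \<open>\<rho>\<close> may then depend on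
  \<open>'h\<close>, the equivalent \<open>'h\<close>-independent condition on the coefficients is required as well: it yields
  a \<open>\<rho>\<close> that works for all Hilbert spaces at once.\<close>

definition free_holomorphic_near_0 ::
    "'h::complex_hilbert itself \<Rightarrow> ('n::finite, real) ncps \<Rightarrow> bool"
  where "free_holomorphic_near_0 H g \<longleftrightarrow>
    (\<exists>\<rho>>0. converges_on_ball H \<rho> g) \<and>
    limsup (\<lambda>k. ereal (root (2 * k) (\<Sum>\<alpha> | length \<alpha> = k. \<bar>coeff g \<alpha>\<bar>\<^sup>2))) < \<infinity>"

definition weighted_creation ::
    "('n, real) ncps \<Rightarrow> 'n \<Rightarrow> 'n list ell2 \<Rightarrow>\<^sub>L 'n list ell2"
  where "weighted_creation g i =
    (THE A. clinear_op A \<and>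
      (\<forall>\<alpha>. blinfun_apply A (fock_basis \<alpha>) =
        sqrt (coeff g \<alpha> / coeff g (i # \<alpha>)) *\<^sub>R fock_basis (i # \<alpha>)))"

definition admissible ::
    "'h::complex_hilbert itself \<Rightarrow> ('n::finite, real) ncps \<Rightarrow> bool"
  where "admissible H g \<longleftrightarrow>
    (coeff g [] = 1 \<and> (\<forall>\<alpha>. 0 < coeff g \<alpha>) \<and>
      (\<forall>i. bdd_above (range (\<lambda>\<alpha>. coeff g \<alpha> / coeff g (i # \<alpha>))))) \<and>
    free_holomorphic_near_0 H g \<and>
    (let a = coeff (ncps_inverse g); W = op_word (weighted_creation g) in
      bdd_above (range (\<lambda>k. norm (\<Sum>p\<le>k. \<Sum>\<alpha> | length \<alpha> = p.
        a \<alpha> *\<^sub>R (W \<alpha> o\<^sub>L cadjoint (W \<alpha>))))))"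

end

theory Submission
  imports Defs
begin

text \<open>
  Write \<open>(1 - x)\<^sup>-\<^sup>s = \<Sum>\<^sub>k c\<^sub>k x\<^sup>k\<close>. For \<open>s \<ge> 1\<close> the positive numbers \<open>c\<^sub>k\<close> are nondecreasing. Keeping
  in \<open>\<phi>\<^sup>k\<^sup>+\<^sup>1 = \<phi> \<phi>\<^sup>k = \<phi>\<^sup>k \<phi>\<close> only the product with the linear term \<open>d\<^sub>i Z\<^sub>i\<close> of \<open>\<phi>\<close> gives both
  inequalities. Each \<open>W\<^sub>\<alpha> W\<^sub>\<alpha>\<^sup>*\<close> is diagonal in the basis \<open>e\<^sub>\<gamma>\<close>, with entry \<open>b\<^sub>\<beta> / b\<^sub>\<gamma>\<close> if \<open>\<gamma> = \<alpha>\<beta>\<close> and \<open>0\<close>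
  otherwise, so the norms in admissibility are at most the supremum over \<open>\<gamma>\<close> of
  \<open>\<Sum> \<bar>a\<^sub>\<alpha>\<bar> b\<^sub>\<beta> / b\<^sub>\<gamma>\<close>, the sum being over all factorizations \<open>\<gamma> = \<alpha>\<beta>\<close>. This is finite, since
  \<open>\<Sum>\<^sub>k \<bar>s gchoose k\<bar> < \<infinity>\<close> and \<open>c\<close> is nondecreasing. Finally \<open>b\<^sub>\<alpha> \<le> C\<^bsup>|\<alpha>|\<^esup>\<close> for some \<open>C\<close>,
  and \<open>\<parallel>X\<^sub>i\<parallel> \<le> \<rho>\<close> on the \<open>\<rho>\<close>-ball.
\<close>

section \<open>Powers of \<open>1 - \<phi>\<close>\<close>

definition power_series :: "(nat \<Rightarrow> real) \<Rightarrow> ('n, real) ncps \<Rightarrow> ('n, real) ncps"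
  where "power_series c \<phi> = Abs_ncps (\<lambda>w. \<Sum>k\<le>length w. c k * coeff (\<phi> ^ k) w)"

lemma coeff_power_eq_0:
  fixes \<phi> :: "('n, 'a::ring_1) ncps"
  assumes "coeff \<phi> [] = 0" "length w < k"
  shows "coeff (\<phi> ^ k) w = 0"
  using assms(2)
proof (induction k arbitrary: w)
  case (Suc k)
  have "coeff \<phi> (take j w) * coeff (\<phi> ^ k) (drop j w) = 0" if "j \<le> length w" for j
  proof (cases "j = 0")
    case False
    then show ?thesis using Suc that by (subst Suc.IH) auto
  qed (simp add: assms(1))
  then show ?case by (simp add: coeff_mult)
qed simp

lemma coeff_power_nonneg:
  fixes \<phi> :: "('n, real) ncps"
  assumes "\<And>w. 0 \<le> coeff \<phi> w"
  shows "0 \<le> coeff (\<phi> ^ k) w"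
  by (induction k arbitrary: w) (auto simp: coeff_one coeff_mult assms intro!: sum_nonneg)

lemma coeff_power_series:
  assumes "coeff \<phi> [] = 0" "length w \<le> N"
  shows "coeff (power_series c \<phi>) w = (\<Sum>k\<le>N. c k * coeff (\<phi> ^ k) w)"
  unfolding power_series_def coeff_Abs_ncps
  by (rule sum.mono_neutral_left) (use assms in \<open>auto simp: coeff_power_eq_0\<close>)

lemma power_series_mult:
  fixes \<phi> :: "('n, real) ncps"
  assumes 0: "coeff \<phi> [] = 0"
  shows "power_series c \<phi> * power_series d \<phi> = power_series (\<lambda>m. \<Sum>k\<le>m. c k * d (m - k)) \<phi>"
  unfolding ncps_eq_iff
proof
  fix w :: "'n list"
  let ?N = "length w"
  have "coeff (power_series c \<phi> * power_series d \<phi>) w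
      = (\<Sum>j\<le>?N. (\<Sum>k\<le>?N. c k * coeff (\<phi> ^ k) (take j w)) * (\<Sum>l\<le>?N. d l * coeff (\<phi> ^ l) (drop j w)))"
    by (simp add: coeff_mult coeff_power_series [OF 0, where N = ?N])
  also have "\<dots> = (\<Sum>j\<le>?N. \<Sum>k\<le>?N. \<Sum>l\<le>?N.
      c k * d l * (coeff (\<phi> ^ k) (take j w) * coeff (\<phi> ^ l) (drop j w)))"
    by (simp add: sum_product mult_ac)
  also have "\<dots> = (\<Sum>k\<le>?N. \<Sum>l\<le>?N. \<Sum>j\<le>?N.
      c k * d l * (coeff (\<phi> ^ k) (take j w) * coeff (\<phi> ^ l) (drop j w)))"
    by (subst sum.swap, rule sum.cong [OF refl], rule sum.swap)
  also have "\<dots> = (\<Sum>k\<le>?N. \<Sum>l\<le>?N. c k * d l * coeff (\<phi> ^ (k + l)) w)"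
    by (simp add: power_add coeff_mult sum_distrib_left)
  also have "\<dots> = (\<Sum>(k, l)\<in>{..?N} \<times> {..?N}. c k * d l * coeff (\<phi> ^ (k + l)) w)"
    by (simp add: sum.cartesian_product)
  also have "\<dots> = (\<Sum>(k, l)\<in>{(i, j). i + j \<le> ?N}. c k * d l * coeff (\<phi> ^ (k + l)) w)"
    by (rule sum.mono_neutral_right) (auto, metis coeff_power_eq_0 [OF 0] not_le)
  also have "\<dots> = (\<Sum>m\<le>?N. \<Sum>k\<le>m. c k * d (m - k) * coeff (\<phi> ^ (k + (m - k))) w)"
    by (rule sum.triangle_reindex_eq)
  also have "\<dots> = coeff (power_series (\<lambda>m. \<Sum>k\<le>m. c k * d (m - k)) \<phi>) w"
    by (simp add: power_series_def sum_distrib_right)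
  finally show "coeff (power_series c \<phi> * power_series d \<phi>) w
      = coeff (power_series (\<lambda>m. \<Sum>k\<le>m. c k * d (m - k)) \<phi>) w" .
qed

lemma power_series_delta: "power_series (\<lambda>k. if k = 0 then 1 else 0) \<phi> = 1"
proof -
  have "(\<Sum>k\<le>length w. (if k = 0 then 1 else 0) * coeff (\<phi> ^ k) w) = coeff 1 w" for w
    by (simp add: if_distrib [of "\<lambda>x. x * _"] sum.delta cong: if_cong)
  then show ?thesis by (simp add: ncps_eq_iff power_series_def)
qed

lemma one_minus_powr_eq:
  assumes "coeff \<phi> [] = 0"
  shows "one_minus_powr \<phi> s = power_series (\<lambda>k. (-1) ^ k * (s gchoose k)) \<phi>"
proof -
  have "(\<Sum>k. (-1) ^ k * (s gchoose k) * coeff (\<phi> ^ k) w)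
      = (\<Sum>k\<le>length w. (-1) ^ k * (s gchoose k) * coeff (\<phi> ^ k) w)" for w
    by (rule suminf_finite) (auto simp: coeff_power_eq_0 assms)
  then show ?thesis by (simp add: one_minus_powr_def power_series_def)
qed

lemma ncps_inverse_unique:
  assumes "f * g = 1" "g * f = 1"
  shows "ncps_inverse f = g"
  unfolding ncps_inverse_def
proof (rule the_equality)
  fix h assume "f * h = 1 \<and> h * f = 1"
  then have "h = h * (f * g)" "h * f = 1" using assms by simp_all
  then show "h = g" by (metis mult.assoc mult_1)
qed (simp add: assms)

definition neg_powr_coeff :: "real \<Rightarrow> nat \<Rightarrow> real"
  where "neg_powr_coeff s k = pochhammer s k / fact k"

lemma neg_powr_coeff_gbinomial: "neg_powr_coeff s k = (-1) ^ k * (- s gchoose k)"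
  by (simp add: neg_powr_coeff_def gbinomial_pochhammer flip: power_mult_distrib)

lemma neg_powr_coeff_0 [simp]: "neg_powr_coeff s 0 = 1"
  by (simp add: neg_powr_coeff_def)

lemma neg_powr_coeff_Suc: "neg_powr_coeff s (Suc k) = neg_powr_coeff s k * ((s + k) / (k + 1))"
  by (simp add: neg_powr_coeff_def pochhammer_Suc field_simps)

context
  fixes s :: real
  assumes s: "1 \<le> s"
begin

lemma neg_powr_coeff_pos: "0 < neg_powr_coeff s k"
  unfolding neg_powr_coeff_def using s by (intro divide_pos_pos pochhammer_pos) auto

lemma neg_powr_coeff_mono: "k \<le> m \<Longrightarrow> neg_powr_coeff s k \<le> neg_powr_coeff s m"
proof (rule lift_Suc_mono_le [of "neg_powr_coeff s"])
  fix k :: nat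
  have "1 \<le> (s + k) / (k + 1)" using s by (simp add: le_divide_eq)
  then show "neg_powr_coeff s k \<le> neg_powr_coeff s (Suc k)"
    using neg_powr_coeff_pos [of k] by (simp only: neg_powr_coeff_Suc mult_le_cancel_left1) simp
qed

lemma neg_powr_coeff_le: "neg_powr_coeff s k \<le> s ^ k"
proof (induction k)
  case (Suc k)
  have "(s + k) / (k + 1) \<le> s"
    using s mult_right_mono [of 1 s k] by (simp add: field_simps)
  then show ?case unfolding neg_powr_coeff_Suc power_Suc2
    using Suc s neg_powr_coeff_pos [of k] by (intro mult_mono) auto
qed simp

lemma abs_gbinomial_sum_bounded: "\<exists>A. \<forall>n. (\<Sum>k\<le>n. \<bar>s gchoose k\<bar>) \<le> A"
proof -
  obtain K :: nat where K: "s - 1 \<le> K" using real_arch_simple by blast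
  define g where "g n = (\<Sum>k\<le>n. \<bar>s gchoose k\<bar>) + \<bar>s - 1 gchoose n\<bar>" for n
  have step: "g (Suc n) = g n" if "K \<le> n" for n
  proof -
    define q where "q = (real n - (s - 1)) / (n + 1)"
    have q: "0 \<le> q" "q \<le> 1" using that K s by (auto simp: q_def)
    have r: "s - 1 gchoose Suc n = - q * (s - 1 gchoose n)"
      using gbinomial_mult_1 [of "s - 1" n] by (simp add: q_def field_simps)
    have "s gchoose Suc n = (1 - q) * (s - 1 gchoose n)"
      using gbinomial_addition_formula [of s n] r by (simp add: algebra_simps)
    then have "\<bar>s gchoose Suc n\<bar> = (1 - q) * \<bar>s - 1 gchoose n\<bar>" using q by (simp add: abs_mult)
    then show ?thesis using q by (simp add: g_def r abs_mult algebra_simps)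
  qed
  have gK: "g n = g K" if "K \<le> n" for n
    using that by (induction n rule: dec_induct) (auto simp: step)
  have "(\<Sum>k\<le>n. \<bar>s gchoose k\<bar>) \<le> g K" for n
  proof -
    have "(\<Sum>k\<le>n. \<bar>s gchoose k\<bar>) \<le> (\<Sum>k\<le>n + K. \<bar>s gchoose k\<bar>)"
      by (rule sum_mono2) auto
    also have "\<dots> \<le> g (n + K)" by (simp add: g_def)
    finally show ?thesis using gK [of "n + K"] by simp
  qed
  then show ?thesis by blast
qed

end

lemma gbinomial_neg_powr_convolution:
  "(\<Sum>k\<le>m. (-1) ^ k * (s gchoose k) * neg_powr_coeff s (m - k)) = (if m = 0 then 1 else 0)"
  "(\<Sum>k\<le>m. neg_powr_coeff s k * ((-1) ^ (m - k) * (s gchoose (m - k)))) = (if m = 0 then 1 else 0)"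
proof -
  have 0: "(0::real) gchoose m = (if m = 0 then 1 else 0)" by (cases m) auto
  have p: "(-1) ^ k * ((-1) ^ (m - k)) = (-1 :: real) ^ m" if "k \<le> m" for k
    using that by (simp flip: power_add)
  have "(\<Sum>k\<le>m. (-1) ^ k * (s gchoose k) * neg_powr_coeff s (m - k))
      = (\<Sum>k\<le>m. (-1) ^ m * ((s gchoose k) * (- s gchoose (m - k))))"
    by (rule sum.cong) (auto simp: neg_powr_coeff_gbinomial mult_ac simp flip: p)
  also have "\<dots> = (-1) ^ m * (0 gchoose m)"
    using gbinomial_Vandermonde [of s "- s" m] by (simp add: atLeast0AtMost flip: sum_distrib_left)
  finally show "(\<Sum>k\<le>m. (-1) ^ k * (s gchoose k) * neg_powr_coeff s (m - k)) = (if m = 0 then 1 else 0)"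
    by (simp add: 0)
  have "(\<Sum>k\<le>m. neg_powr_coeff s k * ((-1) ^ (m - k) * (s gchoose (m - k))))
      = (\<Sum>k\<le>m. (-1) ^ m * ((- s gchoose k) * (s gchoose (m - k))))"
    by (rule sum.cong) (auto simp: neg_powr_coeff_gbinomial mult_ac simp flip: p)
  also have "\<dots> = (-1) ^ m * (0 gchoose m)"
    using gbinomial_Vandermonde [of "- s" s m] by (simp add: atLeast0AtMost flip: sum_distrib_left)
  finally show "(\<Sum>k\<le>m. neg_powr_coeff s k * ((-1) ^ (m - k) * (s gchoose (m - k))))
      = (if m = 0 then 1 else 0)"
    by (simp add: 0)
qed

lemma
  assumes "coeff \<phi> [] = 0"
  shows ncps_inverse_one_minus_powr:
      "ncps_inverse (one_minus_powr \<phi> s) = power_series (neg_powr_coeff s) \<phi>"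
    and ncps_inverse_power_series:
      "ncps_inverse (power_series (neg_powr_coeff s) \<phi>) = one_minus_powr \<phi> s"
proof -
  have 1: "one_minus_powr \<phi> s * power_series (neg_powr_coeff s) \<phi> = 1"
    "power_series (neg_powr_coeff s) \<phi> * one_minus_powr \<phi> s = 1"
    by (simp_all add: one_minus_powr_eq power_series_mult assms gbinomial_neg_powr_convolution
        power_series_delta)
  show "ncps_inverse (one_minus_powr \<phi> s) = power_series (neg_powr_coeff s) \<phi>"
    "ncps_inverse (power_series (neg_powr_coeff s) \<phi>) = one_minus_powr \<phi> s"
    by (rule ncps_inverse_unique; rule 1)+
qed

context
  fixes \<phi> :: "('n, real) ncps" and s :: real
  assumes s: "1 \<le> s" and zero: "coeff \<phi> [] = 0" and nonneg: "\<And>\<alpha>. 0 \<le> coeff \<phi> \<alpha>"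
begin

lemma coeff_mult_Cons_ge:
  assumes "\<And>w. 0 \<le> coeff f w"
  shows "coeff \<phi> [i] * coeff f \<alpha> \<le> coeff (\<phi> * f) (i # \<alpha>)"
  using member_le_sum [of 1 "{..length (i # \<alpha>)}"
      "\<lambda>k. coeff \<phi> (take k (i # \<alpha>)) * coeff f (drop k (i # \<alpha>))"]
  by (simp add: coeff_mult assms nonneg del: sum.atMost_Suc)

lemma coeff_mult_snoc_ge:
  assumes "\<And>w. 0 \<le> coeff f w"
  shows "coeff \<phi> [i] * coeff f \<alpha> \<le> coeff (f * \<phi>) (\<alpha> @ [i])"
  using member_le_sum [of "length \<alpha>" "{..length (\<alpha> @ [i])}"
      "\<lambda>k. coeff f (take k (\<alpha> @ [i])) * coeff \<phi> (drop k (\<alpha> @ [i]))"]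
  by (simp add: coeff_mult assms nonneg mult.commute del: sum.atMost_Suc)

lemma coeff_neg_powr_ge:
  assumes "length \<beta> = Suc (length \<alpha>)"
    and "\<And>k. d * coeff (\<phi> ^ k) \<alpha> \<le> coeff (\<phi> ^ Suc k) \<beta>"
  shows "d * coeff (power_series (neg_powr_coeff s) \<phi>) \<alpha> \<le> coeff (power_series (neg_powr_coeff s) \<phi>) \<beta>"
proof -
  have "d * coeff (power_series (neg_powr_coeff s) \<phi>) \<alpha>
      = (\<Sum>k\<le>length \<alpha>. neg_powr_coeff s k * (d * coeff (\<phi> ^ k) \<alpha>))"
    by (simp add: power_series_def sum_distrib_left mult_ac)
  also have "\<dots> \<le> (\<Sum>k\<le>length \<alpha>. neg_powr_coeff s (Suc k) * coeff (\<phi> ^ Suc k) \<beta>)"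
  proof (rule sum_mono)
    fix k
    have "neg_powr_coeff s k * (d * coeff (\<phi> ^ k) \<alpha>) \<le> neg_powr_coeff s k * coeff (\<phi> ^ Suc k) \<beta>"
      by (intro mult_left_mono assms less_imp_le neg_powr_coeff_pos s)
    also have "\<dots> \<le> neg_powr_coeff s (Suc k) * coeff (\<phi> ^ Suc k) \<beta>"
      by (intro mult_right_mono neg_powr_coeff_mono s coeff_power_nonneg nonneg) simp
    finally show "neg_powr_coeff s k * (d * coeff (\<phi> ^ k) \<alpha>)
        \<le> neg_powr_coeff s (Suc k) * coeff (\<phi> ^ Suc k) \<beta>" .
  qed
  also have "\<dots> \<le> (\<Sum>k\<le>length \<beta>. neg_powr_coeff s k * coeff (\<phi> ^ k) \<beta>)"
    by (simp add: assms(1) sum.atMost_Suc_shift coeff_one del: sum.atMost_Suc power_Suc)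
  finally show ?thesis by (simp add: power_series_def)
qed

lemma coeff_neg_powr_Cons_ge:
  "coeff \<phi> [i] * coeff (power_series (neg_powr_coeff s) \<phi>) \<alpha>
    \<le> coeff (power_series (neg_powr_coeff s) \<phi>) (i # \<alpha>)"
  by (rule coeff_neg_powr_ge) (auto intro!: coeff_mult_Cons_ge coeff_power_nonneg nonneg)

lemma coeff_neg_powr_snoc_ge:
  "coeff \<phi> [i] * coeff (power_series (neg_powr_coeff s) \<phi>) \<alpha>
    \<le> coeff (power_series (neg_powr_coeff s) \<phi>) (\<alpha> @ [i])"
  by (rule coeff_neg_powr_ge)
    (auto simp: power_Suc2 simp del: power_Suc intro!: coeff_mult_snoc_ge coeff_power_nonneg nonneg)

lemma coeff_neg_powr_pos:
  assumes "\<And>i. 0 < coeff \<phi> [i]"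
  shows "0 < coeff (power_series (neg_powr_coeff s) \<phi>) \<alpha>"
proof (induction \<alpha>)
  case Nil
  show ?case by (simp add: power_series_def coeff_one)
next
  case (Cons i \<alpha>)
  show ?case
    using coeff_neg_powr_Cons_ge [of i \<alpha>] mult_pos_pos [OF assms [of i] Cons] by linarith
qed

lemma abs_convolution_bounded:
  "\<exists>A. \<forall>\<gamma>. (\<Sum>j\<le>length \<gamma>. \<bar>coeff (one_minus_powr \<phi> s) (take j \<gamma>)\<bar>
        * coeff (power_series (neg_powr_coeff s) \<phi>) (drop j \<gamma>))
      \<le> A * coeff (power_series (neg_powr_coeff s) \<phi>) \<gamma>"
proof -
  obtain A where A: "\<And>n. (\<Sum>k\<le>n. \<bar>s gchoose k\<bar>) \<le> A"
    using abs_gbinomial_sum_bounded [OF s] by blast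
  let ?\<psi> = "power_series (neg_powr_coeff s) \<phi>"
  let ?f = "power_series (\<lambda>k. \<bar>s gchoose k\<bar>) \<phi>"
  have le: "\<bar>coeff (one_minus_powr \<phi> s) w\<bar> \<le> coeff ?f w" for w
    unfolding one_minus_powr_eq [OF zero] power_series_def coeff_Abs_ncps
    by (rule order_trans [OF sum_abs])
      (simp add: abs_mult power_abs coeff_power_nonneg nonneg)
  have nn: "0 \<le> coeff ?\<psi> w" for w
    unfolding power_series_def coeff_Abs_ncps
    by (intro sum_nonneg mult_nonneg_nonneg coeff_power_nonneg nonneg less_imp_le
        neg_powr_coeff_pos s)
  have "(\<Sum>j\<le>length \<gamma>. \<bar>coeff (one_minus_powr \<phi> s) (take j \<gamma>)\<bar> * coeff ?\<psi> (drop j \<gamma>))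
      \<le> A * coeff ?\<psi> \<gamma>" for \<gamma>
  proof -
    have "(\<Sum>j\<le>length \<gamma>. \<bar>coeff (one_minus_powr \<phi> s) (take j \<gamma>)\<bar> * coeff ?\<psi> (drop j \<gamma>))
        \<le> coeff (?f * ?\<psi>) \<gamma>"
      unfolding coeff_mult by (intro sum_mono mult_right_mono le nn)
    also have "\<dots> = (\<Sum>m\<le>length \<gamma>. (\<Sum>k\<le>m. \<bar>s gchoose k\<bar> * neg_powr_coeff s (m - k)) * coeff (\<phi> ^ m) \<gamma>)"
      unfolding power_series_mult [OF zero] by (simp add: power_series_def)
    also have "\<dots> \<le> (\<Sum>m\<le>length \<gamma>. (A * neg_powr_coeff s m) * coeff (\<phi> ^ m) \<gamma>)"
    proof (intro sum_mono mult_right_mono coeff_power_nonneg nonneg)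
      fix m
      have "(\<Sum>k\<le>m. \<bar>s gchoose k\<bar> * neg_powr_coeff s (m - k))
          \<le> (\<Sum>k\<le>m. \<bar>s gchoose k\<bar> * neg_powr_coeff s m)"
        by (intro sum_mono mult_left_mono neg_powr_coeff_mono s) auto
      also have "\<dots> \<le> A * neg_powr_coeff s m"
        unfolding sum_distrib_right [symmetric]
        by (intro mult_right_mono A less_imp_le neg_powr_coeff_pos s)
      finally show "(\<Sum>k\<le>m. \<bar>s gchoose k\<bar> * neg_powr_coeff s (m - k)) \<le> A * neg_powr_coeff s m" .
    qed
    also have "\<dots> = A * coeff ?\<psi> \<gamma>"
      by (simp add: power_series_def sum_distrib_left mult_ac)
    finally show ?thesis .
  qed
  then show ?thesis by blast
qed

lemma coeff_power_exp_bound: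
  assumes "\<And>w. coeff \<phi> w \<le> D" "1 \<le> D"
  shows "coeff (\<phi> ^ k) w \<le> (2 * D) ^ length w"
proof (induction k arbitrary: w)
  case 0
  show ?case using assms(2) by (simp add: coeff_one)
next
  case (Suc k)
  let ?m = "length w"
  have "coeff \<phi> (take j w) * coeff (\<phi> ^ k) (drop j w) \<le> (if j = 0 then 0 else (1 / 2) ^ j * (2 * D) ^ ?m)"
    if "j \<le> ?m" for j
  proof (cases "j = 0")
    case False
    then have "D \<le> D ^ j" using power_increasing [of 1 j D] assms(2) by simp
    then have "coeff \<phi> (take j w) \<le> D ^ j" using assms(1) [of "take j w"] by linarith
    then have "coeff \<phi> (take j w) * coeff (\<phi> ^ k) (drop j w) \<le> D ^ j * (2 * D) ^ (?m - j)"
      using Suc.IH [of "drop j w"] assms(2)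
      by (intro mult_mono) (auto simp: coeff_power_nonneg nonneg)
    also have "\<dots> = (1 / 2) ^ j * ((2 * D) ^ j * (2 * D) ^ (?m - j))"
      by (simp add: power_mult_distrib power_divide)
    also have "\<dots> = (1 / 2) ^ j * (2 * D) ^ ?m"
      using that by (simp only: power_add [symmetric] le_add_diff_inverse)
    finally show ?thesis using False by simp
  qed (simp add: zero)
  then have "coeff (\<phi> ^ Suc k) w \<le> (\<Sum>j\<le>?m. if j = 0 then 0 else (1 / 2) ^ j * (2 * D) ^ ?m)"
    unfolding power_Suc coeff_mult by (intro sum_mono) simp
  also have "\<dots> = (\<Sum>j=1..?m. (1 / 2) ^ j) * (2 * D) ^ ?m"
    unfolding sum_distrib_right by (rule sum.mono_neutral_cong_right) auto
  also have "(\<Sum>j=1..?m. (1 / 2) ^ j) = 1 - (1 / 2 :: real) ^ ?m"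
    by (induction "length w" arbitrary: w) (simp_all add: sum_gp)
  also have "(1 - (1 / 2) ^ ?m) * (2 * D) ^ ?m \<le> (2 * D) ^ ?m"
    using assms(2) by (simp add: mult_left_le_one_le power_le_one)
  finally show ?case .
qed

lemma coeff_neg_powr_exp_bound:
  assumes "ncps_polynomial \<phi>"
  shows "\<exists>C\<ge>1. \<forall>w. coeff (power_series (neg_powr_coeff s) \<phi>) w \<le> C ^ length w"
proof -
  let ?S = "insert 1 (coeff \<phi> ` {w. coeff \<phi> w \<noteq> 0})"
  define D where "D = Max ?S"
  have fin: "finite ?S" using assms by (simp add: ncps_polynomial_def)
  have D1: "1 \<le> D" unfolding D_def by (rule Max_ge [OF fin]) simp
  have D: "coeff \<phi> w \<le> D" for w
  proof (cases "coeff \<phi> w = 0")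
    case False
    then show ?thesis unfolding D_def by (intro Max_ge [OF fin]) auto
  qed (use D1 in simp)
  let ?C = "2 * (s * (2 * D))"
  have sD: "1 \<le> s * (2 * D)" using s D1 mult_mono [of 1 s 1 "2 * D"] by simp
  have "coeff (power_series (neg_powr_coeff s) \<phi>) w \<le> ?C ^ length w" for w
  proof -
    let ?m = "length w"
    have "coeff (power_series (neg_powr_coeff s) \<phi>) w \<le> (\<Sum>k\<le>?m. s ^ ?m * (2 * D) ^ ?m)"
      unfolding power_series_def coeff_Abs_ncps
    proof (intro sum_mono mult_mono)
      fix k assume "k \<in> {..?m}"
      then show "neg_powr_coeff s k \<le> s ^ ?m"
        using order_trans [OF neg_powr_coeff_le [OF s] power_increasing [OF _ s]] by simp
      show "coeff (\<phi> ^ k) w \<le> (2 * D) ^ ?m" by (rule coeff_power_exp_bound [OF D D1])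
    qed (use s in \<open>auto simp: coeff_power_nonneg nonneg\<close>)
    also have "\<dots> = (real ?m + 1) * (s * (2 * D)) ^ ?m"
      by (simp add: power_mult_distrib algebra_simps)
    also have "\<dots> \<le> 2 ^ ?m * (s * (2 * D)) ^ ?m"
    proof (rule mult_right_mono)
      have "Suc ?m \<le> 2 ^ ?m" by (induction "length w" arbitrary: w) (simp_all add: Suc_leI)
      then show "real ?m + 1 \<le> 2 ^ ?m"
        by (metis Suc_eq_plus1 of_nat_Suc of_nat_le_iff of_nat_numeral of_nat_power add.commute)
    qed (use sD in \<open>intro zero_le_power, linarith\<close>)
    finally show ?thesis by (simp only: power_mult_distrib [of 2 "s * (2 * D)"])
  qed
  moreover have "1 \<le> ?C" using sD by linarith
  ultimately show ?thesis by blast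
qed

end

section \<open>Adjoints and convergence on balls\<close>

lemma cinner_add_right: "cinner x (y + z) = cinner x y + cinner x (z :: 'h::complex_hilbert)"
  by (metis cinner_add_left cinner_commute complex_cnj_add)

lemma cinner_scaleC_right: "cinner x (c *\<^sub>C y) = cnj c * cinner x (y :: 'h::complex_hilbert)"
  by (metis cinner_scaleC_left cinner_commute complex_cnj_mult)

lemma cinner_scaleR_left: "cinner (r *\<^sub>R x) y = r * cinner x (y :: 'h::complex_hilbert)"
  by (metis cinner_scaleC_left scaleC_of_real)

lemma cinner_scaleR_right: "cinner x (r *\<^sub>R y) = r * cinner x (y :: 'h::complex_hilbert)"
  by (metis cinner_scaleC_right scaleC_of_real complex_cnj_complex_of_real)

lemma cinner_diff_right: "cinner x (y - z) = cinner x y - cinner x (z :: 'h::complex_hilbert)"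
  using cinner_add_right [of x "y - z" z] by simp

lemma Re_cinner_commute: "Re (cinner x y) = Re (cinner y (x :: 'h::complex_hilbert))"
  by (metis cinner_commute cnj.sel(1))

lemma norm_add_sq:
  "(norm (x + y))\<^sup>2 = (norm x)\<^sup>2 + 2 * Re (cinner x y) + (norm (y :: 'h::complex_hilbert))\<^sup>2"
proof -
  have "(norm (x + y))\<^sup>2 = Re (cinner (x + y) (x + y))" by (simp only: cinner_self Re_complex_of_real)
  also have "\<dots> = Re (cinner x x) + Re (cinner x y) + Re (cinner y x) + Re (cinner y y)"
    by (simp add: cinner_add_left cinner_add_right)
  finally show ?thesis by (simp add: cinner_self Re_cinner_commute [of y x])
qed

lemma Re_cinner_le: "Re (cinner x y) \<le> norm x * norm (y :: 'h::complex_hilbert)"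
proof -
  have "(norm (x + y))\<^sup>2 \<le> (norm x + norm y)\<^sup>2" by (simp add: norm_triangle_ineq power_mono)
  then show ?thesis by (simp add: norm_add_sq power2_sum)
qed

lemma abs_Re_cinner_le: "\<bar>Re (cinner x y)\<bar> \<le> norm x * norm (y :: 'h::complex_hilbert)"
  using Re_cinner_le [of x y] Re_cinner_le [of "(-1) *\<^sub>R x" y]
  by (simp only: cinner_scaleR_left) simp

lemma cinner_eqI:
  assumes "\<And>x. cinner x y = cinner x (z :: 'h::complex_hilbert)"
  shows "y = z"
proof -
  have "cinner (y - z) (y - z) = 0" by (simp add: cinner_diff_right assms)
  then show ?thesis by (simp add: cinner_self)
qed

text \<open>The representing vector minimises \<open>\<parallel>x\<parallel>\<^sup>2 - 2 g x\<close>; by the parallelogram law every minimising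
  sequence is Cauchy.\<close>

lemma riesz_representation_real:
  fixes g :: "'h::complex_hilbert \<Rightarrow> real"
  assumes g: "bounded_linear g"
  shows "\<exists>z. \<forall>x. g x = Re (cinner x z)"
proof -
  interpret bounded_linear g by (rule g)
  define J where "J x = (norm x)\<^sup>2 - 2 * g x" for x
  obtain M where M: "\<And>x. norm (g x) \<le> norm x * M" using bounded by blast
  have "- M\<^sup>2 \<le> J x" for x
  proof -
    have "g x \<le> norm x * M" using M [of x] by simp
    moreover have "0 \<le> (norm x - M)\<^sup>2" by simp
    ultimately show ?thesis by (simp add: J_def power2_diff)
  qed
  then have bdd: "bdd_below (range J)" by (intro bdd_belowI2)
  define m where "m = Inf (range J)"
  have m: "m \<le> J x" for x unfolding m_def by (rule cInf_lower [OF _ bdd]) simp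
  have "\<exists>x. J x < m + 1 / Suc n" for n
    using cInf_lessD [of "range J" "m + 1 / Suc n"] by (auto simp: m_def)
  then obtain X where X: "\<And>n. J (X n) < m + 1 / Suc n" by metis
  have para: "(norm (x - y))\<^sup>2 = 2 * J x + 2 * J y - 4 * J ((1 / 2) *\<^sub>R (x + y))" for x y
  proof -
    have "(norm (x - y))\<^sup>2 + (norm (x + y))\<^sup>2 = 2 * (norm x)\<^sup>2 + 2 * (norm y)\<^sup>2"
      using norm_add_sq [of x y] norm_add_sq [of x "(-1) *\<^sub>R y"]
      by (simp only: cinner_scaleR_right) simp
    then show ?thesis
      by (simp add: J_def power_mult_distrib power_divide scaleR add add_divide_distrib)
  qed
  have XX: "(norm (X i - X j))\<^sup>2 < 4 / Suc N" if "N \<le> i" "N \<le> j" for i j N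
  proof -
    have "1 / Suc i \<le> 1 / Suc N" "1 / Suc j \<le> 1 / Suc N" using that by (auto simp: frac_le)
    then show ?thesis
      using para [of "X i" "X j"] X [of i] X [of j] m [of "(1 / 2) *\<^sub>R (X i + X j)"] by simp
  qed
  have "Cauchy X"
  proof (rule metric_CauchyI)
    fix e :: real assume "0 < e"
    then obtain N :: nat where N: "4 / e\<^sup>2 < N" using reals_Archimedean2 by blast
    have "4 / Suc N < e\<^sup>2" using N \<open>0 < e\<close> by (simp add: field_simps) (smt (verit) zero_less_power)
    then have "(norm (X i - X j))\<^sup>2 < e\<^sup>2" if "N \<le> i" "N \<le> j" for i j
      using XX [OF that] by linarith
    then show "\<exists>M. \<forall>i\<ge>M. \<forall>j\<ge>M. dist (X i) (X j) < e"
      using \<open>0 < e\<close> by (metis dist_norm power_less_imp_less_base less_imp_le)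
  qed
  then obtain z where z: "X \<longlonglongrightarrow> z" using Cauchy_convergent convergentD by blast
  have "(\<lambda>n. J (X n)) \<longlonglongrightarrow> J z" unfolding J_def by (intro tendsto_intros tendsto z)
  moreover have "(\<lambda>n. m + 1 / Suc n) \<longlonglongrightarrow> m + 0"
    using LIMSEQ_Suc [OF lim_1_over_n] by (intro tendsto_intros) simp
  ultimately have "J z \<le> m + 0"
    by (rule LIMSEQ_le) (use X less_imp_le in blast)
  then have Jz: "J z \<le> m" by simp
  have le: "t * (2 * (g x - Re (cinner x z))) \<le> t\<^sup>2 * (norm x)\<^sup>2" for x t
  proof -
    have "J z \<le> J (z + t *\<^sub>R x)" using Jz m order_trans by blast
    then show ?thesis
      by (simp add: J_def norm_add_sq cinner_scaleR_right add scaleR power_mult_distrib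
          Re_cinner_commute [of z x] algebra_simps)
  qed
  have "g x = Re (cinner x z)" for x
  proof (rule ccontr)
    define d where "d = g x - Re (cinner x z)"
    assume "g x \<noteq> Re (cinner x z)"
    then have d: "d \<noteq> 0" by (simp add: d_def)
    define n where "n = (norm x)\<^sup>2 + 1"
    have n: "0 < n" "(norm x)\<^sup>2 \<le> n" by (auto simp: n_def add_nonneg_pos)
    have "d / n * (2 * d) \<le> (d / n)\<^sup>2 * n"
      using order_trans [OF le [of "d / n" x] mult_left_mono [OF n(2)]] by (simp add: d_def)
    then have "2 * (d\<^sup>2 / n) \<le> d\<^sup>2 / n" using n(1) by (simp add: power2_eq_square)
    moreover have "0 < d\<^sup>2 / n" using d n(1) by simp
    ultimately show False by linarith
  qed
  then show ?thesis by blast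
qed

lemma cinner_cadjoint:
  fixes A :: "'h::complex_hilbert \<Rightarrow>\<^sub>L 'h"
  assumes A: "clinear_op A"
  shows "cinner (blinfun_apply A x) y = cinner x (blinfun_apply (cadjoint A) y)"
proof -
  have ex: "\<exists>z. \<forall>x. cinner (A x) y = cinner x z" for y
  proof -
    have "bounded_linear (\<lambda>x. Re (cinner (A x) y))"
    proof (rule bounded_linear_intro)
      show "norm (Re (cinner (A x) y)) \<le> norm x * (norm A * norm y)" for x
        using order_trans [OF abs_Re_cinner_le mult_right_mono [OF norm_blinfun]]
        by (simp add: mult_ac)
    qed (simp_all add: blinfun.add_right blinfun.scaleR_right cinner_add_left cinner_scaleR_left)
    then obtain z where z: "\<And>x. Re (cinner (A x) y) = Re (cinner x z)"
      using riesz_representation_real by blast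
    have "cinner (A x) y = cinner x z" for x
    proof (rule complex_eqI)
      show "Im (cinner (A x) y) = Im (cinner x z)"
        using z [of "(- \<i>) *\<^sub>C x"] A by (simp add: clinear_op_def cinner_scaleC_left)
    qed (rule z)
    then show ?thesis by blast
  qed
  then obtain f where f: "\<And>x y. cinner (A x) y = cinner x (f y)" by metis
  have "bounded_linear f"
  proof (rule bounded_linear_intro)
    show "f (x + y) = f x + f y" for x y
      by (rule cinner_eqI) (simp add: cinner_add_right flip: f)
    show "f (r *\<^sub>R x) = r *\<^sub>R f x" for r x
      by (rule cinner_eqI) (simp add: cinner_scaleR_right flip: f)
    show "norm (f y) \<le> norm y * norm A" for y
    proof (cases "f y = 0")
      case False
      have "(norm (f y))\<^sup>2 = Re (cinner (A (f y)) y)" by (simp add: f cinner_self)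
      also have "\<dots> \<le> norm (A (f y)) * norm y" by (rule Re_cinner_le)
      also have "\<dots> \<le> norm A * norm (f y) * norm y" by (intro mult_right_mono norm_blinfun) simp
      finally show ?thesis using False by (simp add: power2_eq_square mult_ac)
    qed simp
  qed
  then have B: "cinner (A x) y = cinner x (blinfun_apply (Blinfun f) y)" for x y
    by (simp add: bounded_linear_Blinfun_apply f)
  have "cadjoint A = Blinfun f"
    unfolding cadjoint_def
  proof (rule the_equality)
    fix C assume C: "\<forall>x y. cinner (A x) y = cinner x (blinfun_apply C y)"
    show "C = Blinfun f"
      by (rule blinfun_eqI, rule cinner_eqI) (simp only: B [symmetric] C [rule_format, symmetric])
  qed (simp add: B)
  then show ?thesis by (simp add: B)
qed

lemma norm_le_row_norm:
  fixes X :: "'n::finite \<Rightarrow> 'h::complex_hilbert \<Rightarrow>\<^sub>L 'h"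
  assumes X: "\<And>i. clinear_op (X i)"
  shows "norm (X i) \<le> sqrt (norm (\<Sum>i\<in>UNIV. X i o\<^sub>L cadjoint (X i)))"
proof -
  let ?T = "\<Sum>i\<in>UNIV. X i o\<^sub>L cadjoint (X i)"
  let ?a = "\<lambda>i. blinfun_apply (cadjoint (X i))"
  have adj: "norm (?a i y) \<le> sqrt (norm ?T) * norm y" for y
  proof -
    have sum: "cinner (\<Sum>i\<in>F. f i) z = (\<Sum>i\<in>F. cinner (f i) z)"
      for F :: "'n set" and f and z :: 'h
      by (induction F rule: infinite_finite_induct)
        (use cinner_scaleR_left [of 0 0 z] in \<open>auto simp: cinner_add_left\<close>)
    have "(norm (?a i y))\<^sup>2 \<le> (\<Sum>i\<in>UNIV. (norm (?a i y))\<^sup>2)"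
      by (rule member_le_sum) auto
    also have "\<dots> = Re (cinner (blinfun_apply ?T y) y)"
      by (simp add: blinfun.sum_left sum cinner_cadjoint [OF X] cinner_self)
    also have "\<dots> \<le> norm ?T * norm y * norm y"
      by (rule order_trans [OF Re_cinner_le]) (intro mult_right_mono norm_blinfun norm_ge_zero)
    also have "\<dots> = (sqrt (norm ?T) * norm y)\<^sup>2"
      by (simp add: power_mult_distrib power2_eq_square)
    finally show ?thesis by (rule power2_le_imp_le) simp
  qed
  show ?thesis
  proof (rule norm_blinfun_bound)
    fix x
    show "norm (blinfun_apply (X i) x) \<le> sqrt (norm ?T) * norm x"
    proof (cases "blinfun_apply (X i) x = 0")
      case False
      let ?y = "blinfun_apply (X i) x"
      have "(norm ?y)\<^sup>2 = Re (cinner x (?a i ?y))" by (simp add: cinner_self flip: cinner_cadjoint [OF X])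
      also have "\<dots> \<le> norm x * (sqrt (norm ?T) * norm ?y)"
        by (rule order_trans [OF Re_cinner_le]) (intro mult_left_mono adj norm_ge_zero)
      finally show ?thesis using False by (simp add: power2_eq_square mult_ac)
    qed simp
  qed simp
qed

lemma norm_op_word_le:
  assumes "\<And>i. norm (X i) \<le> r"
  shows "norm (op_word X \<alpha>) \<le> r ^ length \<alpha>"
proof (induction \<alpha>)
  case Nil
  show ?case using norm_blinfun_id_le by simp
next
  case (Cons i \<alpha>)
  have "norm (op_word X (i # \<alpha>)) \<le> norm (X i) * norm (op_word X \<alpha>)"
    by (simp add: norm_blinfun_compose)
  also have "\<dots> \<le> r * r ^ length \<alpha>"
    using Cons assms order_trans [OF norm_ge_zero assms] by (intro mult_mono) auto
  finally show ?case by simp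
qed

lemma card_words: "card {\<alpha> :: 'n::finite list. length \<alpha> = k} = CARD('n) ^ k"
  using card_lists_length_eq [of "UNIV :: 'n set" k] by simp

lemma finite_words: "finite {\<alpha> :: 'n::finite list. length \<alpha> = k}"
  using finite_lists_length_eq [of "UNIV :: 'n set" k] by simp

lemma free_holomorphic_near_0I:
  fixes g :: "('n::finite, real) ncps"
  assumes C: "1 \<le> C" "\<And>w. \<bar>coeff g w\<bar> \<le> C ^ length w"
  shows "free_holomorphic_near_0 TYPE('h::complex_hilbert) g"
proof -
  let ?n = "real CARD('n)"
  have n: "1 \<le> ?n" by (simp add: Suc_leI)
  define \<rho> where "\<rho> = 1 / (2 * ?n * C)"
  have \<rho>: "0 < \<rho>" using n C by (simp add: \<rho>_def)
  have "converges_on_ball TYPE('h) \<rho> g"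
    unfolding converges_on_ball_def
  proof (intro allI impI)
    fix X :: "'n \<Rightarrow> 'h \<Rightarrow>\<^sub>L 'h"
    assume lin: "\<forall>i. clinear_op (X i)"
      and row: "sqrt (norm (\<Sum>i\<in>UNIV. X i o\<^sub>L cadjoint (X i))) \<le> \<rho>"
    have X: "norm (X i) \<le> \<rho>" for i using norm_le_row_norm [of X i] lin row by auto
    show "summable (\<lambda>k. \<Sum>\<alpha> | length \<alpha> = k. coeff g \<alpha> *\<^sub>R op_word X \<alpha>)"
    proof (rule summable_comparison_test')
      show "summable (\<lambda>k. (1 / 2 :: real) ^ k)" by (rule summable_geometric) simp
      fix k
      have "norm (\<Sum>\<alpha> | length \<alpha> = k. coeff g \<alpha> *\<^sub>R op_word X \<alpha>)
          \<le> (\<Sum>\<alpha> :: 'n list | length \<alpha> = k. C ^ k * \<rho> ^ k)"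
      proof (rule order_trans [OF norm_sum sum_mono])
        fix \<alpha> :: "'n list" assume "\<alpha> \<in> {\<alpha>. length \<alpha> = k}"
        then show "norm (coeff g \<alpha> *\<^sub>R op_word X \<alpha>) \<le> C ^ k * \<rho> ^ k"
          using C(1) C(2) [of \<alpha>] norm_op_word_le [of X \<rho> \<alpha>, OF X]
          by (auto intro!: mult_mono)
      qed
      also have "\<dots> = (?n * C * \<rho>) ^ k" by (simp add: card_words power_mult_distrib)
      also have "?n * C * \<rho> = 1 / 2" using n C by (simp add: \<rho>_def)
      finally show "norm (\<Sum>\<alpha> | length \<alpha> = k. coeff g \<alpha> *\<^sub>R op_word X \<alpha>) \<le> (1 / 2) ^ k" .
    qed
  qed
  moreover have "limsup (\<lambda>k. ereal (root (2 * k) (\<Sum>\<alpha> | length \<alpha> = k. \<bar>coeff g \<alpha>\<bar>\<^sup>2))) \<le> ereal (?n * C)"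
  proof (rule Limsup_bounded, rule always_eventually, rule allI)
    fix k
    show "ereal (root (2 * k) (\<Sum>\<alpha> | length \<alpha> = k. \<bar>coeff g \<alpha>\<bar>\<^sup>2)) \<le> ereal (?n * C)"
    proof (cases "k = 0")
      case False
      have "(\<Sum>\<alpha> | length \<alpha> = k. \<bar>coeff g \<alpha>\<bar>\<^sup>2) \<le> (\<Sum>\<alpha> :: 'n list | length \<alpha> = k. (C ^ k)\<^sup>2)"
        using C(2) by (intro sum_mono power_mono) auto
      also have "\<dots> = ?n ^ k * C ^ (2 * k)" by (simp add: card_words mult.commute flip: power_mult)
      also have "\<dots> \<le> ?n ^ (2 * k) * C ^ (2 * k)"
        using n C by (intro mult_right_mono power_increasing) auto
      finally have "root (2 * k) (\<Sum>\<alpha> | length \<alpha> = k. \<bar>coeff g \<alpha>\<bar>\<^sup>2) \<le> root (2 * k) ((?n * C) ^ (2 * k))"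
        using False by (simp add: power_mult_distrib)
      also have "\<dots> = ?n * C" using False n C by (intro real_root_power_cancel) auto
      finally show ?thesis by simp
    qed (use C in simp)
  qed
  ultimately show ?thesis
    unfolding free_holomorphic_near_0_def using \<rho> le_less_trans by fastforce
qed

section \<open>Weighted creation operators\<close>

lemma cinner_fock_basis: "cinner x (fock_basis \<alpha>) = ell2_nth x \<alpha>"
proof -
  have "cinner x (fock_basis \<alpha>) = (\<Sum>\<^sub>\<infinity>\<beta>\<in>{\<alpha>}. ell2_nth x \<beta> * cnj (ell2_nth (fock_basis \<alpha>) \<beta>))"
    unfolding cinner_ell2.rep_eq by (rule infsum_cong_neutral) (auto simp: fock_basis.rep_eq)
  then show ?thesis by (simp add: fock_basis.rep_eq)
qed

lemma ell2_norm_le_componentwise: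
  assumes "0 \<le> A" "\<And>i. cmod (ell2_nth x i) \<le> A * cmod (ell2_nth y i)"
  shows "norm x \<le> A * norm y"
proof (rule ell2_norm_le)
  fix F :: "'a set" assume F: "finite F"
  have "L2_set (\<lambda>i. cmod (ell2_nth x i)) F \<le> L2_set (\<lambda>i. A * cmod (ell2_nth y i)) F"
    by (rule L2_set_mono) (auto simp: assms)
  also have "\<dots> = A * L2_set (\<lambda>i. cmod (ell2_nth y i)) F"
    using assms(1) by (simp add: L2_set_right_distrib)
  also have "\<dots> \<le> A * norm y"
    by (intro mult_left_mono L2_set_le_ell2_norm F assms)
  finally show "L2_set (\<lambda>i. cmod (ell2_nth x i)) F \<le> A * norm y" .
qed (simp add: assms)

lemma clinear_eq_on_basis:
  fixes A B :: "'n list ell2 \<Rightarrow>\<^sub>L 'n list ell2"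
  assumes A: "clinear_op A" and B: "clinear_op B"
    and eq: "\<And>\<alpha>. blinfun_apply A (fock_basis \<alpha>) = blinfun_apply B (fock_basis \<alpha>)"
  shows "A = B"
proof -
  have "cadjoint A = cadjoint B"
  proof (rule blinfun_eqI)
    fix y
    have "ell2_nth (blinfun_apply (cadjoint A) y) \<alpha> = ell2_nth (blinfun_apply (cadjoint B) y) \<alpha>" for \<alpha>
      using cinner_cadjoint [OF A, of "fock_basis \<alpha>" y] cinner_cadjoint [OF B, of "fock_basis \<alpha>" y]
      by (metis cinner_commute cinner_fock_basis eq)
    then show "blinfun_apply (cadjoint A) y = blinfun_apply (cadjoint B) y"
      by (simp add: ell2_eq_iff)
  qed
  then have "cinner (blinfun_apply A x) y = cinner (blinfun_apply B x) y" for x y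
    by (simp add: cinner_cadjoint A B)
  then show ?thesis
    by (intro blinfun_eqI cinner_eqI) (metis cinner_commute)
qed

definition shift_fun :: "('n list \<Rightarrow> real) \<Rightarrow> 'n \<Rightarrow> ('n list \<Rightarrow> complex) \<Rightarrow> 'n list \<Rightarrow> complex"
  where "shift_fun w i f \<gamma> = (case \<gamma> of [] \<Rightarrow> 0 | j # \<beta> \<Rightarrow> if j = i then w \<beta> * f \<beta> else 0)"

lemma L2_set_shift_fun_le:
  assumes w: "\<And>\<beta>. \<bar>w \<beta>\<bar> \<le> M" and F: "finite F"
  shows "L2_set (\<lambda>\<gamma>. cmod (shift_fun w i (ell2_nth x) \<gamma>)) F \<le> M * norm x"
proof -
  have M: "0 \<le> M" using w [of "[]"] by linarith
  let ?G = "{\<beta>. i # \<beta> \<in> F}"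
  have G: "finite ?G" using finite_vimageI [OF F, of "(#) i"] by (simp add: vimage_def)
  have "(\<Sum>\<gamma>\<in>F. (cmod (shift_fun w i (ell2_nth x) \<gamma>))\<^sup>2)
      = (\<Sum>\<gamma>\<in>(#) i ` ?G. (cmod (shift_fun w i (ell2_nth x) \<gamma>))\<^sup>2)"
    by (rule sum.mono_neutral_right [OF F]) (auto simp: shift_fun_def split: list.splits if_splits)
  also have "\<dots> = (\<Sum>\<beta>\<in>?G. (cmod (w \<beta> * ell2_nth x \<beta>))\<^sup>2)"
    by (subst sum.reindex) (auto simp: shift_fun_def)
  finally have "L2_set (\<lambda>\<gamma>. cmod (shift_fun w i (ell2_nth x) \<gamma>)) F
      = L2_set (\<lambda>\<beta>. cmod (w \<beta> * ell2_nth x \<beta>)) ?G" by (simp add: L2_set_def)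
  also have "\<dots> \<le> L2_set (\<lambda>\<beta>. M * cmod (ell2_nth x \<beta>)) ?G"
    by (rule L2_set_mono) (auto simp: norm_mult intro!: mult_right_mono w)
  also have "\<dots> = M * L2_set (\<lambda>\<beta>. cmod (ell2_nth x \<beta>)) ?G"
    using M by (simp add: L2_set_right_distrib)
  also have "\<dots> \<le> M * norm x" by (intro mult_left_mono L2_set_le_ell2_norm G M)
  finally show ?thesis .
qed

lemma weighted_creation_exists:
  assumes "\<And>\<beta>. \<bar>w \<beta>\<bar> \<le> M"
  shows "\<exists>A :: 'n list ell2 \<Rightarrow>\<^sub>L 'n list ell2. clinear_op A \<and>
    (\<forall>x \<gamma>. ell2_nth (blinfun_apply A x) \<gamma> = shift_fun w i (ell2_nth x) \<gamma>)"
proof -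
  define T where "T x = Abs_ell2 (shift_fun w i (ell2_nth x))" for x
  have T: "ell2_nth (T x) \<gamma> = shift_fun w i (ell2_nth x) \<gamma>" for x \<gamma>
  proof -
    have "(\<lambda>\<gamma>. (cmod (shift_fun w i (ell2_nth x) \<gamma>))\<^sup>2) summable_on UNIV"
      unfolding sq_summable_iff by (intro exI allI impI) (rule L2_set_shift_fun_le [OF assms])
    then show ?thesis by (simp add: T_def Abs_ell2_inverse)
  qed
  have M: "0 \<le> M" using assms [of "[]"] by linarith
  have lin: "bounded_linear T"
  proof (rule bounded_linear_intro)
    show "norm (T x) \<le> norm x * M" for x
      unfolding mult.commute [of _ M]
      by (rule ell2_norm_le) (simp_all add: T M L2_set_shift_fun_le [OF assms])
  qed (auto simp: ell2_eq_iff T plus_ell2.rep_eq scaleR_ell2.rep_eq shift_fun_def distrib_left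
      split: list.split)
  show ?thesis
  proof (intro exI conjI allI)
    show "clinear_op (Blinfun T)"
      by (auto simp: clinear_op_def bounded_linear_Blinfun_apply [OF lin] ell2_eq_iff T
          scaleC_ell2.rep_eq shift_fun_def split: list.split)
    show "ell2_nth (blinfun_apply (Blinfun T) x) \<gamma> = shift_fun w i (ell2_nth x) \<gamma>" for x \<gamma>
      by (simp add: bounded_linear_Blinfun_apply [OF lin] T)
  qed
qed

lemma clinear_op_word: "(\<And>i. clinear_op (X i)) \<Longrightarrow> clinear_op (op_word X \<alpha>)"
  by (induction \<alpha>) (simp_all add: clinear_op_def)

context
  fixes g :: "('n::finite, real) ncps"
  assumes pos: "\<And>\<alpha>. 0 < coeff g \<alpha>"
    and bdd: "\<And>i. bdd_above (range (\<lambda>\<alpha>. coeff g \<alpha> / coeff g (i # \<alpha>)))"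
begin

lemma
  shows clinear_weighted_creation: "clinear_op (weighted_creation g i)"
    and ell2_nth_weighted_creation: "ell2_nth (blinfun_apply (weighted_creation g i) x) \<gamma>
      = shift_fun (\<lambda>\<beta>. sqrt (coeff g \<beta> / coeff g (i # \<beta>))) i (ell2_nth x) \<gamma>"
proof -
  let ?w = "\<lambda>\<beta>. sqrt (coeff g \<beta> / coeff g (i # \<beta>))"
  obtain M where "\<And>\<beta>. coeff g \<beta> / coeff g (i # \<beta>) \<le> M"
    using bdd [of i] by (auto simp: bdd_above_def)
  then have "\<bar>?w \<beta>\<bar> \<le> sqrt M" for \<beta> using pos by (simp add: less_imp_le)
  then obtain A :: "'n list ell2 \<Rightarrow>\<^sub>L 'n list ell2" where A: "clinear_op A"
    and nth: "\<And>x \<gamma>. ell2_nth (blinfun_apply A x) \<gamma> = shift_fun ?w i (ell2_nth x) \<gamma>"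
    using weighted_creation_exists [of ?w "sqrt M" i] by blast
  have basis: "blinfun_apply A (fock_basis \<alpha>) = ?w \<alpha> *\<^sub>R fock_basis (i # \<alpha>)" for \<alpha>
    by (auto simp: ell2_eq_iff nth shift_fun_def scaleR_ell2.rep_eq fock_basis.rep_eq
        split: list.split)
  have "weighted_creation g i = A"
    unfolding weighted_creation_def
    by (rule the_equality) (auto simp: A basis intro!: clinear_eq_on_basis)
  then show "clinear_op (weighted_creation g i)"
    "ell2_nth (blinfun_apply (weighted_creation g i) x) \<gamma> = shift_fun ?w i (ell2_nth x) \<gamma>"
    by (simp_all add: A nth)
qed

lemma ell2_nth_creation_word:
  "ell2_nth (blinfun_apply (op_word (weighted_creation g) \<alpha>) x) \<gamma>
    = (if take (length \<alpha>) \<gamma> = \<alpha>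
       then sqrt (coeff g (drop (length \<alpha>) \<gamma>) / coeff g \<gamma>) * ell2_nth x (drop (length \<alpha>) \<gamma>) else 0)"
proof (induction \<alpha> arbitrary: \<gamma>)
  case Nil
  show ?case using pos [of \<gamma>] by simp
next
  case (Cons i \<alpha>)
  show ?case
  proof (cases \<gamma>)
    case (Cons j \<delta>)
    have "coeff g \<delta> \<noteq> 0" using pos [of \<delta>] by simp
    then show ?thesis
      by (simp add: ell2_nth_weighted_creation shift_fun_def Cons Cons.IH
          flip: of_real_mult real_sqrt_mult)
  qed (simp add: ell2_nth_weighted_creation shift_fun_def)
qed

lemma ell2_nth_cadjoint_creation_word:
  "ell2_nth (blinfun_apply (cadjoint (op_word (weighted_creation g) \<alpha>)) y) \<beta>
    = sqrt (coeff g \<beta> / coeff g (\<alpha> @ \<beta>)) * ell2_nth y (\<alpha> @ \<beta>)"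
proof -
  let ?W = "op_word (weighted_creation g) \<alpha>"
  let ?c = "sqrt (coeff g \<beta> / coeff g (\<alpha> @ \<beta>))"
  have W: "blinfun_apply ?W (fock_basis \<beta>) = ?c *\<^sub>R fock_basis (\<alpha> @ \<beta>)"
    unfolding ell2_eq_iff
  proof
    fix \<gamma>
    show "ell2_nth (blinfun_apply ?W (fock_basis \<beta>)) \<gamma> = ell2_nth (?c *\<^sub>R fock_basis (\<alpha> @ \<beta>)) \<gamma>"
      using append_take_drop_id [of "length \<alpha>" \<gamma>]
      by (cases "take (length \<alpha>) \<gamma> = \<alpha>")
        (auto simp: ell2_nth_creation_word fock_basis.rep_eq scaleR_ell2.rep_eq)
  qed
  have "ell2_nth (blinfun_apply (cadjoint ?W) y) \<beta>
      = cnj (cinner (fock_basis \<beta>) (blinfun_apply (cadjoint ?W) y))"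
    by (metis cinner_commute cinner_fock_basis)
  also have "\<dots> = cnj (cinner (blinfun_apply ?W (fock_basis \<beta>)) y)"
    by (simp add: cinner_cadjoint clinear_op_word clinear_weighted_creation)
  also have "\<dots> = cinner y (?c *\<^sub>R fock_basis (\<alpha> @ \<beta>))" by (metis W cinner_commute)
  finally show ?thesis by (simp add: cinner_scaleR_right cinner_fock_basis)
qed

lemma ell2_nth_creation_word_range_projection:
  "ell2_nth (blinfun_apply (op_word (weighted_creation g) \<alpha>
        o\<^sub>L cadjoint (op_word (weighted_creation g) \<alpha>)) y) \<gamma>
    = (if take (length \<alpha>) \<gamma> = \<alpha> then coeff g (drop (length \<alpha>) \<gamma>) / coeff g \<gamma> * ell2_nth y \<gamma> else 0)"
proof (cases "take (length \<alpha>) \<gamma> = \<alpha>")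
  case True
  then have "\<alpha> @ drop (length \<alpha>) \<gamma> = \<gamma>" by (metis append_take_drop_id)
  then show ?thesis
    using True pos by (simp add: ell2_nth_creation_word ell2_nth_cadjoint_creation_word
        less_imp_le flip: mult.assoc of_real_mult)
qed (simp add: ell2_nth_creation_word)

lemma norm_diagonal_sum_le:
  assumes "\<And>\<gamma>. (\<Sum>j\<le>length \<gamma>. \<bar>a (take j \<gamma>)\<bar> * coeff g (drop j \<gamma>)) \<le> A * coeff g \<gamma>"
  shows "norm (\<Sum>p\<le>k. \<Sum>\<alpha> | length \<alpha> = p. a \<alpha> *\<^sub>R (op_word (weighted_creation g) \<alpha>
      o\<^sub>L cadjoint (op_word (weighted_creation g) \<alpha>))) \<le> A"
proof (rule norm_blinfun_bound)
  let ?P = "\<lambda>\<alpha>. op_word (weighted_creation g) \<alpha> o\<^sub>L cadjoint (op_word (weighted_creation g) \<alpha>)"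
  have "0 \<le> A * coeff g []"
    by (rule order_trans [OF _ assms [of "[]"]]) (simp add: less_imp_le pos)
  then show A: "0 \<le> A" using pos [of "[]"] by (simp add: zero_le_mult_iff)
  fix y
  have nth_sum: "ell2_nth (sum f S) \<gamma> = (\<Sum>i\<in>S. ell2_nth (f i) \<gamma>)"
    for f :: "'i \<Rightarrow> 'n list ell2" and S \<gamma>
    by (induction S rule: infinite_finite_induct) (auto simp: zero_ell2.rep_eq plus_ell2.rep_eq)
  show "norm (blinfun_apply (\<Sum>p\<le>k. \<Sum>\<alpha> | length \<alpha> = p. a \<alpha> *\<^sub>R ?P \<alpha>) y) \<le> A * norm y"
  proof (rule ell2_norm_le_componentwise [OF A])
    fix \<gamma>
    let ?c = "\<lambda>p. a (take p \<gamma>) * (coeff g (drop p \<gamma>) / coeff g \<gamma>)"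
    have inner: "(\<Sum>\<alpha> | length \<alpha> = p. ell2_nth (blinfun_apply (a \<alpha> *\<^sub>R ?P \<alpha>) y) \<gamma>)
        = (if p \<le> length \<gamma> then ?c p * ell2_nth y \<gamma> else 0)" for p
    proof -
      have "(\<Sum>\<alpha> | length \<alpha> = p. ell2_nth (blinfun_apply (a \<alpha> *\<^sub>R ?P \<alpha>) y) \<gamma>)
          = (\<Sum>\<alpha> | length \<alpha> = p. if take p \<gamma> = \<alpha> then ?c p * ell2_nth y \<gamma> else 0)"
        by (rule sum.cong)
          (auto simp: blinfun.scaleR_left scaleR_ell2.rep_eq ell2_nth_creation_word_range_projection
            simp del: blinfun_apply_blinfun_compose)
      also have "\<dots> = (if p \<le> length \<gamma> then ?c p * ell2_nth y \<gamma> else 0)"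
        by (subst sum.delta' [OF finite_words]) auto
      finally show ?thesis .
    qed
    have "ell2_nth (blinfun_apply (\<Sum>p\<le>k. \<Sum>\<alpha> | length \<alpha> = p. a \<alpha> *\<^sub>R ?P \<alpha>) y) \<gamma>
        = (\<Sum>p\<le>k. if p \<le> length \<gamma> then ?c p * ell2_nth y \<gamma> else 0)"
      by (simp only: blinfun.sum_left nth_sum inner)
    also have "cmod \<dots> \<le> (\<Sum>p\<le>k. if p \<le> length \<gamma>
        then \<bar>a (take p \<gamma>)\<bar> * (coeff g (drop p \<gamma>) / coeff g \<gamma>) * cmod (ell2_nth y \<gamma>) else 0)"
      using pos by (intro order_trans [OF norm_sum sum_mono]) (auto simp: norm_mult norm_divide less_imp_le)
    also have "\<dots> = (\<Sum>p\<in>{..k} \<inter> {..length \<gamma>}.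
        \<bar>a (take p \<gamma>)\<bar> * (coeff g (drop p \<gamma>) / coeff g \<gamma>) * cmod (ell2_nth y \<gamma>))"
      by (rule sum.mono_neutral_cong_right) auto
    also have "\<dots> \<le> (\<Sum>p\<le>length \<gamma>.
        \<bar>a (take p \<gamma>)\<bar> * (coeff g (drop p \<gamma>) / coeff g \<gamma>) * cmod (ell2_nth y \<gamma>))"
      using pos by (intro sum_mono2) (auto simp: less_imp_le)
    also have "\<dots> = (\<Sum>p\<le>length \<gamma>. \<bar>a (take p \<gamma>)\<bar> * coeff g (drop p \<gamma>)) / coeff g \<gamma> * cmod (ell2_nth y \<gamma>)"
      by (simp add: sum_distrib_right sum_divide_distrib)
    also have "\<dots> \<le> A * cmod (ell2_nth y \<gamma>)"
      using assms [of \<gamma>] pos [of \<gamma>] by (intro mult_right_mono) (auto simp: divide_le_eq)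
    finally show "cmod (ell2_nth (blinfun_apply (\<Sum>p\<le>k. \<Sum>\<alpha> | length \<alpha> = p. a \<alpha> *\<^sub>R ?P \<alpha>) y) \<gamma>)
        \<le> A * cmod (ell2_nth y \<gamma>)" .
  qed
qed

end

theorem proposition4p9:
  fixes \<phi> \<psi> :: "('n::finite, real) ncps" and s :: real
  assumes "1 \<le> s"
    and "coeff \<phi> [] = 0"
    and "\<And>\<alpha>. 0 \<le> coeff \<phi> \<alpha>"
    and "\<And>i. 0 < coeff \<phi> [i]"
    and "\<psi> = ncps_inverse (one_minus_powr \<phi> s)"
  shows "(\<forall>\<alpha> i. coeff \<psi> (i # \<alpha>) \<noteq> 0 \<and>
             coeff \<psi> \<alpha> / coeff \<psi> (i # \<alpha>) \<le> 1 / coeff \<phi> [i]) \<and>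
         (\<forall>\<alpha> i. coeff \<psi> (\<alpha> @ [i]) \<noteq> 0 \<and>
             coeff \<psi> \<alpha> / coeff \<psi> (\<alpha> @ [i]) \<le> 1 / coeff \<phi> [i]) \<and>
         (ncps_polynomial \<phi> \<longrightarrow> admissible TYPE('h::complex_hilbert) \<psi>)"
proof -
  have \<psi>: "\<psi> = power_series (neg_powr_coeff s) \<phi>"
    using assms(5) ncps_inverse_one_minus_powr [OF assms(2)] by simp
  have pos: "0 < coeff \<psi> \<alpha>" for \<alpha>
    unfolding \<psi> by (rule coeff_neg_powr_pos [OF assms(1-4)])
  have ratio: "coeff \<psi> \<alpha> / coeff \<psi> \<beta> \<le> 1 / coeff \<phi> [i]"
    if "coeff \<phi> [i] * coeff \<psi> \<alpha> \<le> coeff \<psi> \<beta>" for i \<alpha> \<beta>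
    using that pos [of \<beta>] assms(4) [of i] by (simp add: field_simps)
  have left: "coeff \<psi> \<alpha> / coeff \<psi> (i # \<alpha>) \<le> 1 / coeff \<phi> [i]" for i \<alpha>
    by (rule ratio) (unfold \<psi>, rule coeff_neg_powr_Cons_ge [OF assms(1-3)])
  have right: "coeff \<psi> \<alpha> / coeff \<psi> (\<alpha> @ [i]) \<le> 1 / coeff \<phi> [i]" for i \<alpha>
    by (rule ratio) (unfold \<psi>, rule coeff_neg_powr_snoc_ge [OF assms(1-3)])
  have bdd: "bdd_above (range (\<lambda>\<alpha>. coeff \<psi> \<alpha> / coeff \<psi> (i # \<alpha>)))" for i
    using left by (intro bdd_aboveI2)
  have "admissible TYPE('h) \<psi>" if poly: "ncps_polynomial \<phi>"
  proof -
    obtain C where "1 \<le> C" "\<And>w. coeff \<psi> w \<le> C ^ length w"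
      using coeff_neg_powr_exp_bound [OF assms(1-3) poly] unfolding \<psi> by blast
    then have hol: "free_holomorphic_near_0 TYPE('h) \<psi>"
      using pos by (intro free_holomorphic_near_0I) (auto simp: abs_of_pos)
    have inv: "ncps_inverse \<psi> = one_minus_powr \<phi> s"
      unfolding \<psi> by (rule ncps_inverse_power_series [OF assms(2)])
    obtain A where A: "\<And>\<gamma>. (\<Sum>j\<le>length \<gamma>. \<bar>coeff (ncps_inverse \<psi>) (take j \<gamma>)\<bar> * coeff \<psi> (drop j \<gamma>))
        \<le> A * coeff \<psi> \<gamma>"
      using abs_convolution_bounded [OF assms(1-3)] unfolding inv unfolding \<psi> by blast
    have "coeff \<psi> [] = 1" by (simp add: \<psi> power_series_def coeff_one)
    then show ?thesis
      unfolding admissible_def Let_def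
      using pos bdd hol norm_diagonal_sum_le [OF pos bdd A] by (intro conjI bdd_aboveI2) auto
  qed
  then show ?thesis using left right pos by (metis less_irrefl)
qed

end
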